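(* Let $0<\epsilon<1$ and let $G=([n],E)$ be a DAG with $E\supseteq\{(i,i+1):i<n\}$, all edges $(u,v)$ satisfying $u<v$, and maximum indegree $\Delta\ge1$, such that $G$ is $(e,d)$-depth-robust for all integers $e,d\ge0$ with $e+d\le(1-\epsilon)n$. Then $\Pi^{BW}_{cc}(G)\ge(1/16-\epsilon/2)n^2$. Furthermore, if $G'$ is the indegree-reduced version of $G$ (on $2n\Delta$ nodes), then $\Pi^{BW}_{cc}(G')\ge(1/16-\epsilon/2)n^2$. In particular, there is a family of DAGs $\{G_n\}$, $G_n$ on $n$ nodes with maximum indegree $O(\log n)$, with $\Pi^{BW}_{cc}(G_n)=\Omega(n^2)$, and a family of DAGs $\{H_n\}$, $H_n$ on $n$ nodes with maximum indegree at most $2$, with $\Pi^{BW}_{cc}(H_n)=\Omega\left(\frac{n^2}{\log^2 n}\right)$.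
   Context: For a DAG $G$, $\mathsf{depth}(G)$ is the number of nodes on a longest directed path; $G-S$ is $G$ with the nodes of $S$ and incident edges removed. $G$ is $(e,d)$-depth-robust if $\mathsf{depth}(G-S)\ge d$ for every node set $S$ with $|S|\le e$. Indegree-reduced version: given a DAG $D=([n],E)$ with maximum indegree $\Delta\ge 1$ whose edges $(u,v)$ all satisfy $u<v$, its indegree-reduced version is the DAG on node set $[2n\Delta]$ whose edges are exactly: for each $v\in[n]$ and $1\le j<2\Delta$, the edge $(2(v-1)\Delta+j,\,2(v-1)\Delta+j+1)$; and, if $u_1<\cdots<u_k$ ($k\le\Delta$) are the parents of $v$ in $D$, for each $i\in[k]$ the edge $(2u_i\Delta,\,2(v-1)\Delta+i)$. A parallel-black sequential-white pebbling of $G=(V,E)$ is a sequence $P=(P_0,\ldots,P_t)$ of pairs $P_i=(P_i^B,P_i^W)$ of subsets of $V$ such that: $P_0=(\emptyset,\emptyset)$; $P_t^W=\emptyset$; $|P_i^W\setminus P_{i-1}^W|\le1$ for all $i\in[t]$; for all $i\in[t]$, if $x\in P_{i-1}^W\setminus P_i^W$ then $\mathsf{parents}(x)\subseteq P_{i-1}^W\cup P_{i-1}^B$; for all $i\in[t]$, if $x\in P_i^B\setminus P_{i-1}^B$ then $\mathsf{parents}(x)\subseteq P_{i-1}^W\cup P_{i-1}^B$; and every sink $x$ of $G$ lies in $P_z^W\cup P_z^B$ for some $z\le t$. $\Pi^{BW}_{cc}(G)=\min_P\sum_{i=1}^t|P_i^B\cup P_i^W|$ over all such pebblings. *)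

theory Defs
  imports Complex_Main "HOL-Library.Landau_Symbols"
begin

(* Graphs: node set V :: nat set, edge set E :: (nat \<times> nat) set.
   The DAG on [n] has node set {1..n}. *)

definition parents :: "(nat \<times> nat) set \<Rightarrow> nat \<Rightarrow> nat set" where
  "parents E v = {u. (u, v) \<in> E}"

definition is_path :: "(nat \<times> nat) set \<Rightarrow> nat list \<Rightarrow> bool" where
  "is_path E xs \<longleftrightarrow> xs \<noteq> [] \<and> (\<forall>i. Suc i < length xs \<longrightarrow> (xs ! i, xs ! Suc i) \<in> E)"

(* number of nodes on a longest directed path using only nodes of V
   (so depth (V - S) E is the depth of G - S) *)
definition depth :: "nat set \<Rightarrow> (nat \<times> nat) set \<Rightarrow> nat" where
  "depth V E = Sup {length xs | xs. is_path E xs \<and> set xs \<subseteq> V}"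

definition depth_robust :: "nat set \<Rightarrow> (nat \<times> nat) set \<Rightarrow> nat \<Rightarrow> nat \<Rightarrow> bool" where
  "depth_robust V E e d \<longleftrightarrow> (\<forall>S. S \<subseteq> V \<and> card S \<le> e \<longrightarrow> depth (V - S) E \<ge> d)"

definition max_indeg :: "nat set \<Rightarrow> (nat \<times> nat) set \<Rightarrow> nat" where
  "max_indeg V E = Max (insert 0 ((\<lambda>v. card (parents E v)) ` V))"

definition is_sink :: "nat set \<Rightarrow> (nat \<times> nat) set \<Rightarrow> nat \<Rightarrow> bool" where
  "is_sink V E x \<longleftrightarrow> x \<in> V \<and> (\<forall>y. (x, y) \<notin> E)"

definition is_dag :: "nat set \<Rightarrow> (nat \<times> nat) set \<Rightarrow> bool" where
  "is_dag V E \<longleftrightarrow> finite V \<and> E \<subseteq> V \<times> V \<and> acyclic E"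

(* parallel-black sequential-white pebbling P_0,...,P_t; P i = (P_i^B, P_i^W) *)
definition is_bw_pebbling ::
  "nat set \<Rightarrow> (nat \<times> nat) set \<Rightarrow> (nat \<Rightarrow> nat set \<times> nat set) \<Rightarrow> nat \<Rightarrow> bool" where
  "is_bw_pebbling V E P t \<longleftrightarrow>
     (\<forall>i\<le>t. fst (P i) \<subseteq> V \<and> snd (P i) \<subseteq> V) \<and>
     P 0 = ({}, {}) \<and>
     snd (P t) = {} \<and>
     (\<forall>i\<in>{1..t}. card (snd (P i) - snd (P (i - 1))) \<le> 1) \<and>
     (\<forall>i\<in>{1..t}. \<forall>x \<in> snd (P (i - 1)) - snd (P i).
        parents E x \<subseteq> snd (P (i - 1)) \<union> fst (P (i - 1))) \<and>
     (\<forall>i\<in>{1..t}. \<forall>x \<in> fst (P i) - fst (P (i - 1)).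
        parents E x \<subseteq> snd (P (i - 1)) \<union> fst (P (i - 1))) \<and>
     (\<forall>x. is_sink V E x \<longrightarrow> (\<exists>z\<le>t. x \<in> snd (P z) \<union> fst (P z)))"

definition bw_cost :: "(nat \<Rightarrow> nat set \<times> nat set) \<Rightarrow> nat \<Rightarrow> nat" where
  "bw_cost P t = (\<Sum>i=1..t. card (fst (P i) \<union> snd (P i)))"

definition Pi_bw_cc :: "nat set \<Rightarrow> (nat \<times> nat) set \<Rightarrow> nat" where
  "Pi_bw_cc V E = Inf {bw_cost P t | P t. is_bw_pebbling V E P t}"

(* indegree-reduced version of a DAG D = ([n], E) with maximum indegree \<Delta>;
   node set {1..2 n \<Delta>} *)
definition ir_edges :: "nat \<Rightarrow> nat \<Rightarrow> (nat \<times> nat) set \<Rightarrow> (nat \<times> nat) set" where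
  "ir_edges n \<Delta> E =
     {(2 * (v - 1) * \<Delta> + j, 2 * (v - 1) * \<Delta> + j + 1) | v j.
        v \<in> {1..n} \<and> 1 \<le> j \<and> j < 2 * \<Delta>} \<union>
     {(2 * (sorted_list_of_set (parents E v) ! (i - 1)) * \<Delta>, 2 * (v - 1) * \<Delta> + i) | v i.
        v \<in> {1..n} \<and> i \<in> {1..card (parents E v)}}"

end

theory Submission
  imports Defs "HOL-Library.FuncSet" "HOL-Real_Asymp.Real_Asymp"
begin

text \<open>
  Cut the time axis at all moments congruent to \<open>i\<close> modulo \<open>d\<close>, and let \<open>B\<close> be the set of nodes
  pebbled at one of these moments; averaging over \<open>i\<close>, some \<open>B\<close> satisfies \<open>d * |B| \<le> cost\<close>. A node
  outside \<open>B\<close> carries no pebble at the cuts, so it is pebbled together with all its ancestors in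
  \<open>G - B\<close> within a single interval between cuts. At most \<open>d\<close> nodes \<open>W\<close> become white in that
  interval, and among the other nodes black pebbles advance one step per time unit. Hence a path of
  ancestors that avoids \<open>B\<close> and \<open>W\<close> has at most \<open>d\<close> nodes. If \<open>G\<close> is sufficiently depth-robust and
  \<open>d\<close> is about \<open>n/4\<close>, this forces \<open>B\<close> to have linear size. The argument is insensitive to replacing
  nodes by gadgets, which gives the indegree-reduced version.

  For the families, much less robustness than \<open>e + d \<le> (1 - \<epsilon>) n\<close> suffices. It is provided by graphs
  that expand between nearby dyadic blocks of every scale (Erdos, Graham and Szemeredi): all nodes
  around which the deleted set is sparse at every scale still lie on one common path.
\<close>

subsection \<open>Bottlenecks of a pebbling\<close>

definition pebbled :: "(nat \<Rightarrow> nat set \<times> nat set) \<Rightarrow> nat \<Rightarrow> nat set" where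
  "pebbled P i = fst (P i) \<union> snd (P i)"

lemma nat_switch_on:
  assumes "Q (b::nat)" "\<not> Q a" "a \<le> b"
  shows "\<exists>c\<ge>a. c < b \<and> \<not> Q c \<and> Q (Suc c)"
proof (rule ccontr)
  assume *: "\<not> ?thesis"
  have "c \<ge> a \<Longrightarrow> c \<le> b \<Longrightarrow> \<not> Q c" for c
  proof (induction c rule: dec_induct)
    case base
    then show ?case using assms by simp
  next
    case (step c)
    then show ?case using * by (metis Suc_le_eq less_imp_le)
  qed
  then show False using assms by auto
qed

lemma black_placed:
  assumes P: "is_bw_pebbling V E P t" and "\<tau> \<le> t" "lo \<le> \<tau>"
    and "x \<in> fst (P \<tau>)" "x \<notin> fst (P lo)" and "(y, x) \<in> E"
  shows "\<exists>\<sigma>\<ge>lo. \<sigma> < \<tau> \<and> y \<in> pebbled P \<sigma>"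
proof -
  obtain \<sigma> where \<sigma>: "\<sigma> \<ge> lo" "\<sigma> < \<tau>" "x \<notin> fst (P \<sigma>)" "x \<in> fst (P (Suc \<sigma>))"
    using nat_switch_on[of "\<lambda>i. x \<in> fst (P i)" \<tau> lo] assms by blast
  have "Suc \<sigma> \<in> {1..t}" using \<sigma> \<open>\<tau> \<le> t\<close> by auto
  then have "parents E x \<subseteq> snd (P (Suc \<sigma> - 1)) \<union> fst (P (Suc \<sigma> - 1))"
    using P \<sigma> unfolding is_bw_pebbling_def by (metis DiffI diff_Suc_1)
  then show ?thesis
    using \<sigma> \<open>(y, x) \<in> E\<close> by (auto simp: parents_def pebbled_def)
qed

lemma white_removed:
  assumes P: "is_bw_pebbling V E P t" and "hi \<le> t" "\<tau> \<le> hi"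
    and "x \<in> snd (P \<tau>)" "x \<notin> snd (P hi)" and "(y, x) \<in> E"
  shows "\<exists>\<sigma>\<ge>\<tau>. \<sigma> < hi \<and> y \<in> pebbled P \<sigma>"
proof -
  obtain \<sigma> where \<sigma>: "\<sigma> \<ge> \<tau>" "\<sigma> < hi" "x \<in> snd (P \<sigma>)" "x \<notin> snd (P (Suc \<sigma>))"
    using nat_switch_on[of "\<lambda>i. x \<notin> snd (P i)" hi \<tau>] assms by blast
  have "Suc \<sigma> \<in> {1..t}" using \<sigma> \<open>hi \<le> t\<close> by auto
  then have "parents E x \<subseteq> snd (P (Suc \<sigma> - 1)) \<union> fst (P (Suc \<sigma> - 1))"
    using P \<sigma> unfolding is_bw_pebbling_def by (metis DiffI diff_Suc_1)
  then show ?thesis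
    using \<sigma> \<open>(y, x) \<in> E\<close> by (auto simp: parents_def pebbled_def)
qed

text \<open>A black pebble is justified by the parents at its placement, which lies before
  \<open>\<tau>\<close>; a white one by the parents at its removal, which lies after. The conditions
  at \<open>lo\<close> and \<open>hi\<close> force that moment into the interval.\<close>

lemma parent_pebbled_in_interval:
  assumes P: "is_bw_pebbling V E P t" and "hi \<le> t" "lo \<le> \<tau>" "\<tau> \<le> hi"
    and "x \<in> pebbled P \<tau>" "x \<notin> pebbled P lo" "x \<notin> snd (P hi)" and "(y, x) \<in> E"
  shows "\<exists>\<sigma>\<in>{lo..hi}. y \<in> pebbled P \<sigma>"
proof (cases "x \<in> fst (P \<tau>)")
  case True
  then obtain \<sigma> where "\<sigma> \<ge> lo" "\<sigma> < \<tau>" "y \<in> pebbled P \<sigma>"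
    using black_placed[OF P, of \<tau> lo x y] assms by (auto simp: pebbled_def)
  then show ?thesis using assms by auto
next
  case False
  then obtain \<sigma> where "\<sigma> \<ge> \<tau>" "\<sigma> < hi" "y \<in> pebbled P \<sigma>"
    using white_removed[OF P, of hi \<tau> x y] assms by (auto simp: pebbled_def)
  then show ?thesis using assms by auto
qed

lemma pebbled_0: "is_bw_pebbling V E P t \<Longrightarrow> pebbled P 0 = {}"
  by (simp add: is_bw_pebbling_def pebbled_def)

lemma pebbled_subset: "is_bw_pebbling V E P t \<Longrightarrow> i \<le> t \<Longrightarrow> pebbled P i \<subseteq> V"
  by (auto simp: is_bw_pebbling_def pebbled_def)

text \<open>Only sinks are required to be pebbled. The rest follows by induction against the edges,
  applying \<open>parent_pebbled_in_interval\<close> to the whole run: time 0 is bare and time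
  \<open>t\<close> has no white pebble.\<close>

lemma every_node_pebbled:
  assumes P: "is_bw_pebbling V E P t" and "finite E" "acyclic E" "E \<subseteq> V \<times> V"
    and "x \<in> V"
  shows "\<exists>\<tau>\<in>{1..t}. x \<in> pebbled P \<tau>"
proof -
  have wf: "wf (E\<inverse>)" using assms finite_acyclic_wf_converse by blast
  have "x \<in> V \<longrightarrow> (\<exists>\<tau>\<le>t. x \<in> pebbled P \<tau>)" for x
  proof (induction x rule: wf_induct[OF wf])
    case (1 x)
    show ?case
    proof (cases "is_sink V E x")
      case True
      then show ?thesis using P unfolding is_bw_pebbling_def pebbled_def by blast
    next
      case False
      show ?thesis
      proof
        assume "x \<in> V"
        then obtain y where y: "(x, y) \<in> E" using False by (auto simp: is_sink_def)
        then obtain \<tau> where "\<tau> \<le> t" "y \<in> pebbled P \<tau>" using 1 assms by blast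
        then show "\<exists>\<tau>\<le>t. x \<in> pebbled P \<tau>"
          using parent_pebbled_in_interval[OF P, of t 0 \<tau> y x] y pebbled_0[OF P] P
          by (auto simp: is_bw_pebbling_def)
      qed
    qed
  qed
  then obtain \<tau> where \<tau>: "\<tau> \<le> t" "x \<in> pebbled P \<tau>" using assms by blast
  then have "\<tau> \<noteq> 0" using pebbled_0[OF P] by (cases \<tau>) auto
  with \<tau> show ?thesis by (intro bexI[of _ \<tau>]) auto
qed

text \<open>For \<open>n < 16\<close> the quadratic bound is at most \<open>n\<close>, so this crude
  estimate settles the small graphs.\<close>

lemma bw_cost_ge_card:
  assumes P: "is_bw_pebbling V E P t" and "finite V" "E \<subseteq> V \<times> V" "acyclic E"
  shows "card V \<le> bw_cost P t"
proof -
  have fE: "finite E" using assms finite_subset by blast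
  have "V \<subseteq> (\<Union>\<tau>\<in>{1..t}. pebbled P \<tau>)"
    using every_node_pebbled[OF P fE] assms by blast
  then have "card V \<le> card (\<Union>\<tau>\<in>{1..t}. pebbled P \<tau>)"
    using finite_subset[OF pebbled_subset[OF P] \<open>finite V\<close>] by (intro card_mono) auto
  also have "\<dots> \<le> bw_cost P t"
    unfolding bw_cost_def pebbled_def by (rule card_UN_le) simp
  finally show ?thesis .
qed

text \<open>This is where the sequentiality of white moves enters; black moves admit no such
  bound.\<close>

lemma card_white_placed:
  assumes P: "is_bw_pebbling V E P t" and "hi \<le> t"
  shows "card (\<Union>\<tau>\<in>{lo<..hi}. snd (P \<tau>) - snd (P (\<tau> - 1))) \<le> hi - lo"
proof -
  have "card (\<Union>\<tau>\<in>{lo<..hi}. snd (P \<tau>) - snd (P (\<tau> - 1)))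
      \<le> (\<Sum>\<tau>\<in>{lo<..hi}. card (snd (P \<tau>) - snd (P (\<tau> - 1))))"
    by (rule card_UN_le) simp
  also have "\<dots> \<le> (\<Sum>\<tau>\<in>{lo<..hi}. 1)"
    using P \<open>hi \<le> t\<close> unfolding is_bw_pebbling_def by (intro sum_mono) auto
  finally show ?thesis by simp
qed

text \<open>Along a path of nodes that carry no pebble at time \<open>lo\<close> and never a white one, the times of
  first (black) pebbling strictly increase, so an interval of length \<open>hi - lo\<close> is too short for
  more than \<open>hi - lo\<close> such nodes.\<close>

lemma card_black_chain_le:
  assumes P: "is_bw_pebbling V E P t" and "hi \<le> t"
    and lo: "pebbled P lo \<inter> U = {}"
    and white: "\<And>\<tau>. \<tau> \<in> {lo..hi} \<Longrightarrow> snd (P \<tau>) \<inter> U = {}"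
    and Y: "Y \<subseteq> U" "total_on Y ((Restr E U)\<^sup>+)"
    and peb: "\<And>y. y \<in> Y \<Longrightarrow> \<exists>\<tau>\<in>{lo..hi}. y \<in> pebbled P \<tau>"
  shows "card Y \<le> hi - lo"
proof -
  define T where "T y = (LEAST \<tau>. lo \<le> \<tau> \<and> y \<in> pebbled P \<tau>)" for y
  define A where "A = {y. \<exists>\<tau>\<in>{lo..hi}. y \<in> pebbled P \<tau>}"
  have T: "lo \<le> T y \<and> y \<in> pebbled P (T y) \<and> T y \<le> hi" if y: "y \<in> A" for y
  proof -
    obtain \<tau> where \<tau>: "lo \<le> \<tau>" "\<tau> \<le> hi" "y \<in> pebbled P \<tau>" using y by (auto simp: A_def)
    then have "lo \<le> T y \<and> y \<in> pebbled P (T y)" unfolding T_def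
      by (intro LeastI[of "\<lambda>\<tau>. lo \<le> \<tau> \<and> y \<in> pebbled P \<tau>" \<tau>]) auto
    moreover have "T y \<le> \<tau>" unfolding T_def using \<tau> by (intro Least_le) auto
    ultimately show ?thesis using \<tau> by auto
  qed
  have edge: "y \<in> A \<and> T y < T x" if yx: "(y, x) \<in> Restr E U" and x: "x \<in> A" for x y
  proof -
    have "x \<in> fst (P (T x))"
      using T[OF x] white[of "T x"] yx by (auto simp: pebbled_def)
    moreover have "x \<notin> fst (P lo)" using lo yx by (auto simp: pebbled_def)
    ultimately obtain \<sigma> where \<sigma>: "\<sigma> \<ge> lo" "\<sigma> < T x" "y \<in> pebbled P \<sigma>"
      using black_placed[OF P, of "T x" lo x y] T[OF x] yx \<open>hi \<le> t\<close> by auto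
    then have "y \<in> A" using T[OF x] by (force simp: A_def)
    moreover have "T y \<le> \<sigma>" unfolding T_def using \<sigma> by (intro Least_le) auto
    ultimately show ?thesis using \<sigma> by auto
  qed
  have chain: "x \<in> A \<longrightarrow> y \<in> A \<and> T y < T x" if "(y, x) \<in> (Restr E U)\<^sup>+" for x y
    using that
  proof (induction rule: trancl_induct)
    case (base x)
    then show ?case using edge by blast
  next
    case (step x z)
    then show ?case using edge by (meson order_less_trans)
  qed
  have YA: "Y \<subseteq> A" using peb by (auto simp: A_def)
  have "inj_on T Y"
  proof (rule inj_onI, rule ccontr)
    fix x y assume "x \<in> Y" "y \<in> Y" "T x = T y" "x \<noteq> y"
    then have "(x, y) \<in> (Restr E U)\<^sup>+ \<or> (y, x) \<in> (Restr E U)\<^sup>+"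
      using Y by (auto simp: total_on_def)
    then show False using chain YA \<open>x \<in> Y\<close> \<open>y \<in> Y\<close> \<open>T x = T y\<close> by (metis less_irrefl subsetD)
  qed
  \<comment> \<open>\<open>U\<close> is bare at \<open>lo\<close>, so the left end is excluded;
    otherwise \<open>hi - lo + 1\<close> times would be possible.\<close>
  moreover have "T ` Y \<subseteq> {lo<..hi}"
  proof
    fix \<tau> assume "\<tau> \<in> T ` Y"
    then obtain y where y: "y \<in> Y" "\<tau> = T y" by auto
    have "T y \<noteq> lo" using T[of y] y YA lo Y by auto
    then show "\<tau> \<in> {lo<..hi}" using T[of y] y YA by auto
  qed
  ultimately show ?thesis
    using card_inj_on_le[of T Y "{lo<..hi}"] by simp
qed

text \<open>Iterates \<open>parent_pebbled_in_interval\<close> along the path. Black pebbles on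
  \<open>U\<close> are allowed at \<open>hi\<close>, because they may survive at the end of a
  pebbling, where \<open>hi = t\<close>.\<close>

lemma ancestor_pebbled_in_interval:
  assumes P: "is_bw_pebbling V E P t" and "hi \<le> t"
    and lo: "pebbled P lo \<inter> U = {}" and hi: "snd (P hi) \<inter> U = {}"
    and "(y, z) \<in> (Restr E U)\<^sup>*"
    and "\<exists>\<tau>\<in>{lo..hi}. z \<in> pebbled P \<tau>"
  shows "\<exists>\<tau>\<in>{lo..hi}. y \<in> pebbled P \<tau>"
  using assms(5,6)
proof (induction rule: converse_rtrancl_induct)
  case base
  then show ?case .
next
  case (step y x)
  then obtain \<tau> where "lo \<le> \<tau>" "\<tau> \<le> hi" "x \<in> pebbled P \<tau>" by auto
  then show ?case
    using parent_pebbled_in_interval[OF P, of hi lo \<tau> x y] step lo hi \<open>hi \<le> t\<close> by auto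
qed

text \<open>\<open>B\<close> is the union of the configurations at all times congruent to a suitable \<open>i\<close> modulo \<open>d\<close>.
  A node \<open>z\<close> outside \<open>B\<close> is pebbled strictly between two such times, and then so are
  all its ancestors in \<open>G - B\<close>. \<open>W\<close> is the set of nodes receiving a white pebble in that interval;
  since white moves are sequential, it has at most \<open>d\<close> elements.\<close>

lemma pebbling_bottleneck:
  assumes P: "is_bw_pebbling V E P t" and V: "finite V" "E \<subseteq> V \<times> V" "acyclic E" and "d \<ge> 1"
  shows "\<exists>B\<subseteq>V. d * card B \<le> bw_cost P t \<and>
    (\<forall>z\<in>V - B. \<exists>W\<subseteq>V. card W \<le> d \<and>
      (\<forall>Y\<subseteq>V - B - W. total_on Y ((Restr E (V - B - W))\<^sup>+) \<longrightarrow>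
         (\<forall>y\<in>Y. (y, z) \<in> (Restr E (V - B))\<^sup>*) \<longrightarrow> card Y \<le> d))"
proof -
  define I where "I i = {\<tau>\<in>{1..t}. \<tau> mod d = i}" for i
  define B where "B i = (\<Union>\<tau>\<in>I i. pebbled P \<tau>)" for i
  have "(\<Sum>i<d. card (B i)) \<le> (\<Sum>i<d. \<Sum>\<tau>\<in>I i. card (pebbled P \<tau>))"
    unfolding B_def I_def by (intro sum_mono card_UN_le) simp
  also have "\<dots> = (\<Sum>\<tau>\<in>{1..t}. card (pebbled P \<tau>))"
    unfolding I_def using \<open>d \<ge> 1\<close> by (intro sum.group) auto
  finally have sum_le: "(\<Sum>i<d. card (B i)) \<le> bw_cost P t"
    by (simp add: bw_cost_def pebbled_def)
  have "\<exists>i<d. d * card (B i) \<le> bw_cost P t"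
  proof (rule ccontr)
    assume "\<not> ?thesis"
    then have "(\<Sum>i<d. bw_cost P t) < (\<Sum>i<d. d * card (B i))"
      using \<open>d \<ge> 1\<close> by (intro sum_strict_mono) (auto simp: not_le lessThan_empty_iff)
    then show False using sum_le \<open>d \<ge> 1\<close> by (simp flip: sum_distrib_left)
  qed
  then obtain i where i: "i < d" "d * card (B i) \<le> bw_cost P t" by auto
  have BV: "B i \<subseteq> V" using pebbled_subset[OF P] by (auto simp: B_def I_def)
  have "\<exists>W\<subseteq>V. card W \<le> d \<and>
      (\<forall>Y\<subseteq>V - B i - W. total_on Y ((Restr E (V - B i - W))\<^sup>+) \<longrightarrow>
         (\<forall>y\<in>Y. (y, z) \<in> (Restr E (V - B i))\<^sup>*) \<longrightarrow> card Y \<le> d)" if z: "z \<in> V - B i" for z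
  proof -
    have "finite E" using V finite_subset by blast
    then obtain \<tau> where \<tau>: "\<tau> \<in> {1..t}" "z \<in> pebbled P \<tau>"
      using every_node_pebbled[OF P _ V(3,2)] z by blast
    \<comment> \<open>Adding \<open>d\<close> keeps \<open>\<tau> - i\<close> from being truncated.
      Then \<open>lo\<close> is the last time congruent to \<open>i\<close> that is at most
      \<open>\<tau>\<close>, and \<open>hi\<close> is the next one. At the borders \<open>lo\<close>
      becomes 0 (by truncation, when \<open>s = 0\<close>), where nothing is pebbled, and
      \<open>hi\<close> becomes \<open>t\<close>, where nothing is white.\<close>
    define s where "s = (\<tau> + d - i) div d * d"
    define lo where "lo = s + i - d"
    define hi where "hi = min t (s + i)"
    have s_le: "s \<le> \<tau> + d - i" unfolding s_def by simp
    have s_gt: "\<tau> + d - i < s + d" unfolding s_def using \<open>d \<ge> 1\<close>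
      by (metis One_nat_def add.commute dividend_less_div_times less_eq_Suc_le)
    have lohi: "lo \<le> \<tau>" "\<tau> \<le> hi" "hi \<le> t" "hi - lo \<le> d"
      using s_le s_gt \<tau> i by (auto simp: lo_def hi_def)
    have lo_cases: "lo = 0 \<or> lo \<in> I i"
    proof (cases "s = 0")
      case True
      then show ?thesis using i by (simp add: lo_def)
    next
      case False
      then obtain q where "s = Suc q * d" unfolding s_def by (metis mult_is_0 not0_implies_Suc)
      then have "lo = q * d + i" by (simp add: lo_def)
      then have "lo mod d = i" using i by simp
      then show ?thesis using lohi \<tau> by (auto simp: I_def)
    qed
    have hi_cases: "hi = t \<or> hi \<in> I i"
    proof (cases "t \<le> s + i")
      case False
      then have "hi = s + i" by (simp add: hi_def)
      then have "hi mod d = i" using i by (simp add: s_def)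
      then show ?thesis using lohi \<tau> by (auto simp: I_def)
    qed (simp add: hi_def)
    have lo_free: "pebbled P lo \<inter> (V - B i) = {}"
      using lo_cases pebbled_0[OF P] by (auto simp: B_def)
    have hi_free: "snd (P hi) \<inter> (V - B i) = {}"
      using hi_cases P by (auto simp: B_def pebbled_def is_bw_pebbling_def)
    define W where "W = (\<Union>\<tau>\<in>{lo<..hi}. snd (P \<tau>) - snd (P (\<tau> - 1)))"
    have "snd (P \<sigma>) \<subseteq> V" if "\<sigma> \<in> {lo<..hi}" for \<sigma>
      using pebbled_subset[OF P, of \<sigma>] that lohi by (auto simp: pebbled_def)
    then have "W \<subseteq> V" unfolding W_def by blast
    moreover have "card W \<le> d"
      using card_white_placed[OF P lohi(3), of lo] lohi unfolding W_def by linarith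
    moreover have "card Y \<le> d"
      if Y: "Y \<subseteq> V - B i - W" "total_on Y ((Restr E (V - B i - W))\<^sup>+)"
        "\<forall>y\<in>Y. (y, z) \<in> (Restr E (V - B i))\<^sup>*" for Y
    proof -
      have "card Y \<le> hi - lo"
      proof (rule card_black_chain_le[OF P lohi(3) _ _ Y(1,2)])
        show "pebbled P lo \<inter> (V - B i - W) = {}" using lo_free by auto
        show "snd (P \<sigma>) \<inter> (V - B i - W) = {}" if \<sigma>: "\<sigma> \<in> {lo..hi}" for \<sigma>
        proof (rule ccontr)
          assume "\<not> ?thesis"
          then obtain x where x: "x \<in> snd (P \<sigma>)" "x \<in> V - B i" "x \<notin> W" by auto
          have "x \<notin> snd (P lo)" using lo_free x by (auto simp: pebbled_def)
          then obtain c where "c \<ge> lo" "c < \<sigma>" "x \<notin> snd (P c)" "x \<in> snd (P (Suc c))"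
            using nat_switch_on[of "\<lambda>i. x \<in> snd (P i)" \<sigma> lo] x \<sigma> by auto
          then have "x \<in> W" using \<sigma> by (auto simp: W_def intro!: bexI[of _ "Suc c"])
          then show False using x by simp
        qed
        show "\<exists>\<tau>\<in>{lo..hi}. y \<in> pebbled P \<tau>" if "y \<in> Y" for y
        proof (rule ancestor_pebbled_in_interval[OF P lohi(3) lo_free hi_free])
          show "(y, z) \<in> (Restr E (V - B i))\<^sup>*" using Y that by blast
          show "\<exists>\<tau>\<in>{lo..hi}. z \<in> pebbled P \<tau>" using \<tau> lohi by auto
        qed
      qed
      then show ?thesis using lohi by linarith
    qed
    ultimately show ?thesis by blast
  qed
  then show ?thesis using BV i by blast
qed

subsection \<open>Robustness under gadget replacement\<close>

text \<open>Black pebbles alone, placed in numerical order and never removed. The infimum defining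
  \<open>Pi_bw_cc\<close> thus ranges over a nonempty set and is attained.\<close>

lemma pebbling_exists:
  assumes "finite V" "E \<subseteq> V \<times> V" "\<forall>u v. (u, v) \<in> E \<longrightarrow> u < v"
  shows "\<exists>P t. is_bw_pebbling V E P t"
proof -
  define P where "P i = ({x\<in>V. 1 \<le> i \<and> x < i}, {} :: nat set)" for i :: nat
  obtain t where t: "\<forall>x\<in>V. x < t" using \<open>finite V\<close> finite_nat_set_iff_bounded by auto
  have "x < t \<and> 1 \<le> t" if "x \<in> V" for x using t that by force
  then have sink: "\<exists>z\<le>t. x \<in> snd (P z) \<union> fst (P z)" if "is_sink V E x" for x
    using that by (intro exI[of _ t]) (auto simp: P_def is_sink_def)
  have "parents E x \<subseteq> snd (P (i - 1)) \<union> fst (P (i - 1))"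
    if "i \<in> {1..t}" "x \<in> fst (P i) - fst (P (i - 1))" for i x
  proof
    fix u assume "u \<in> parents E x"
    then have "u < x" "u \<in> V" "x \<in> V" using assms by (auto simp: parents_def)
    then show "u \<in> snd (P (i - 1)) \<union> fst (P (i - 1))" using that by (auto simp: P_def)
  qed
  with sink have "is_bw_pebbling V E P t"
    unfolding is_bw_pebbling_def by (auto simp: P_def)
  then show ?thesis by blast
qed

lemma acyclic_increasing:
  fixes E :: "(nat \<times> nat) set"
  assumes "\<forall>u v. (u, v) \<in> E \<longrightarrow> u < v"
  shows "acyclic E"
proof -
  have "(u, v) \<in> E\<^sup>+ \<Longrightarrow> u < v" for u v
    by (induction rule: trancl_induct) (use assms in \<open>auto intro: less_trans\<close>)
  then show ?thesis by (auto simp: acyclic_def)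
qed

lemma Pi_bw_cc_attained:
  assumes "finite V" "E \<subseteq> V \<times> V" "\<forall>u v. (u, v) \<in> E \<longrightarrow> u < v"
  obtains P t where "is_bw_pebbling V E P t" "Pi_bw_cc V E = bw_cost P t"
proof -
  have "{bw_cost P t | P t. is_bw_pebbling V E P t} \<noteq> {}"
    using pebbling_exists[OF assms] by blast
  then have "Pi_bw_cc V E \<in> {bw_cost P t | P t. is_bw_pebbling V E P t}"
    unfolding Pi_bw_cc_def by (rule Inf_nat_def1)
  then show ?thesis using that by blast
qed

lemma Pi_bw_cc_ge_card:
  assumes "finite V" "E \<subseteq> V \<times> V" "\<forall>u v. (u, v) \<in> E \<longrightarrow> u < v"
  shows "card V \<le> Pi_bw_cc V E"
proof -
  obtain P t where "is_bw_pebbling V E P t" "Pi_bw_cc V E = bw_cost P t"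
    using Pi_bw_cc_attained[OF assms] by blast
  then show ?thesis using bw_cost_ge_card acyclic_increasing assms by simp
qed

text \<open>The robustness that defeats \<open>pebbling_bottleneck\<close>: after deleting any \<open>B\<close> there is a node
  \<open>z\<close>, chosen before \<open>W\<close>, such that deleting also \<open>W\<close> leaves more than \<open>d\<close>
  ancestors of \<open>z\<close> on a common path.\<close>

definition chain_robust :: "nat \<Rightarrow> (nat \<times> nat) set \<Rightarrow> nat \<Rightarrow> nat \<Rightarrow> bool" where
  "chain_robust n E b d \<longleftrightarrow> (\<forall>B\<subseteq>{1..n}. card B \<le> b \<longrightarrow>
     (\<exists>z\<in>{1..n} - B. \<forall>W\<subseteq>{1..n}. card W \<le> d \<longrightarrow>
       (\<exists>Y\<subseteq>{1..n} - B - W. d < card Y \<and> total_on Y ((Restr E ({1..n} - B - W))\<^sup>+) \<and>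
          (\<forall>y\<in>Y. (y, z) \<in> (Restr E ({1..n} - B))\<^sup>*))))"

text \<open>\<open>blk\<close> contracts each gadget of \<open>(V, F)\<close> to a node of \<open>([n], E)\<close>, and \<open>tip v\<close> is the exit of
  the gadget of \<open>v\<close>. Both \<open>G\<close> itself and its indegree-reduced version have this form.\<close>

definition lifts :: "nat \<Rightarrow> (nat \<times> nat) set \<Rightarrow> nat set \<Rightarrow> (nat \<times> nat) set \<Rightarrow> (nat \<Rightarrow> nat) \<Rightarrow> (nat \<Rightarrow> nat) \<Rightarrow> bool" where
  "lifts n E V F blk tip \<longleftrightarrow> (\<forall>v\<in>{1..n}. tip v \<in> V \<and> blk (tip v) = v) \<and>
     (\<forall>(u, v)\<in>E. (tip u, tip v) \<in> (Restr F {x\<in>V. x = tip u \<or> blk x = v})\<^sup>+)"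

text \<open>The path replacing an edge \<open>(u, v)\<close> uses only \<open>tip u\<close> and the
  gadget of \<open>v\<close>, so it survives the deletion of all gadgets outside
  \<open>U\<close>.\<close>

lemma lifts_trancl:
  assumes l: "lifts n E V F blk tip" and "U \<subseteq> {1..n}" and "(x, y) \<in> (Restr E U)\<^sup>+"
  shows "(tip x, tip y) \<in> (Restr F {x\<in>V. blk x \<in> U})\<^sup>+"
proof -
  have edge: "(tip u, tip v) \<in> (Restr F {x\<in>V. blk x \<in> U})\<^sup>+" if "(u, v) \<in> Restr E U" for u v
  proof -
    have "(tip u, tip v) \<in> (Restr F {x\<in>V. x = tip u \<or> blk x = v})\<^sup>+" "blk (tip u) = u"
      using l that \<open>U \<subseteq> {1..n}\<close> unfolding lifts_def by auto
    moreover have "Restr F {x\<in>V. x = tip u \<or> blk x = v} \<subseteq> Restr F {x\<in>V. blk x \<in> U}"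
      using that \<open>blk (tip u) = u\<close> by auto
    ultimately show ?thesis using trancl_mono by blast
  qed
  show ?thesis using assms(3)
    by (induction rule: trancl_induct) (blast intro: edge trancl_trans)+
qed

lemma lifts_rtrancl:
  assumes l: "lifts n E V F blk tip" and "U \<subseteq> {1..n}" and "(x, y) \<in> (Restr E U)\<^sup>*"
  shows "(tip x, tip y) \<in> (Restr F {x\<in>V. blk x \<in> U})\<^sup>*"
  using assms(3) lifts_trancl[OF l \<open>U \<subseteq> {1..n}\<close>, of x y]
  by (auto simp: rtrancl_eq_or_trancl)

text \<open>A smaller cost would give a bottleneck \<open>B\<close> of at most \<open>b\<close>
  nodes. Contracting gadgets sends \<open>B\<close> and \<open>W\<close> to subsets of
  \<open>[n]\<close> that are no larger, and \<open>tip\<close> carries the chain provided by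
  \<open>chain_robust\<close> back to one that contradicts
  \<open>pebbling_bottleneck\<close>.\<close>

lemma chain_robust_cost:
  assumes rob: "chain_robust n E b d" and l: "lifts n E V F blk tip" and "d \<ge> 1"
    and V: "finite V" "F \<subseteq> V \<times> V" "\<forall>u v. (u, v) \<in> F \<longrightarrow> u < v"
  shows "d * (b + 1) \<le> Pi_bw_cc V F"
proof (rule ccontr)
  assume less: "\<not> ?thesis"
  obtain P t where P: "is_bw_pebbling V F P t" "Pi_bw_cc V F = bw_cost P t"
    using Pi_bw_cc_attained V by blast
  obtain B where B: "B \<subseteq> V" "d * card B \<le> bw_cost P t"
    and bottleneck: "\<And>z. z \<in> V - B \<Longrightarrow> \<exists>W\<subseteq>V. card W \<le> d \<and>
      (\<forall>Y\<subseteq>V - B - W. total_on Y ((Restr F (V - B - W))\<^sup>+) \<longrightarrow>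
         (\<forall>y\<in>Y. (y, z) \<in> (Restr F (V - B))\<^sup>*) \<longrightarrow> card Y \<le> d)"
    using pebbling_bottleneck[OF P(1) V(1,2) acyclic_increasing[OF V(3)] \<open>d \<ge> 1\<close>] by metis
  have "d * card B < d * (b + 1)" using B less P by linarith
  then have "card B \<le> b" by (metis Suc_eq_plus1 less_Suc_eq_le mult_less_cancel1)
  have fin: "finite X" if "X \<subseteq> V" for X using that V(1) finite_subset by blast
  \<comment> \<open>A single node of \<open>X\<close> deletes its whole gadget. The intersection
    discards nodes that belong to no gadget, such as the padding in
    \<open>two_indegree_family\<close>.\<close>
  define b1 where "b1 X = blk ` X \<inter> {1..n}" for X
  have b1: "b1 X \<subseteq> {1..n}" "card (b1 X) \<le> card X" if "X \<subseteq> V" for X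
  proof -
    have "card (b1 X) \<le> card (blk ` X)" unfolding b1_def
      using fin[OF that] by (intro card_mono) auto
    then show "card (b1 X) \<le> card X" using card_image_le[OF fin[OF that], of blk] by linarith
  qed (auto simp: b1_def)
  \<comment> \<open>\<open>z\<close> depends on \<open>B\<close> only, so it can be fixed before
    \<open>W\<close>, which the bottleneck supplies for \<open>tip z\<close>.\<close>
  obtain z where z: "z \<in> {1..n} - b1 B"
    and rz: "\<And>W. W \<subseteq> {1..n} \<Longrightarrow> card W \<le> d \<Longrightarrow>
       \<exists>Y\<subseteq>{1..n} - b1 B - W. d < card Y \<and> total_on Y ((Restr E ({1..n} - b1 B - W))\<^sup>+) \<and>
          (\<forall>y\<in>Y. (y, z) \<in> (Restr E ({1..n} - b1 B))\<^sup>*)"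
    using rob b1[OF B(1)] \<open>card B \<le> b\<close> unfolding chain_robust_def by (meson order_trans)
  have tip: "tip v \<in> V" "blk (tip v) = v" if "v \<in> {1..n}" for v
    using l that by (auto simp: lifts_def)
  have notin: "tip v \<notin> X" if "v \<in> {1..n} - b1 X" for v X
    using tip[of v] that by (force simp: b1_def)
  obtain W where W: "W \<subseteq> V" "card W \<le> d"
    and bW: "\<And>Y. Y \<subseteq> V - B - W \<Longrightarrow> total_on Y ((Restr F (V - B - W))\<^sup>+) \<Longrightarrow>
         (\<forall>y\<in>Y. (y, tip z) \<in> (Restr F (V - B))\<^sup>*) \<Longrightarrow> card Y \<le> d"
    using bottleneck[of "tip z"] tip[of z] notin[OF z] z by blast
  obtain Y where Y: "Y \<subseteq> {1..n} - b1 B - b1 W" "d < card Y"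
    "total_on Y ((Restr E ({1..n} - b1 B - b1 W))\<^sup>+)"
    "\<forall>y\<in>Y. (y, z) \<in> (Restr E ({1..n} - b1 B))\<^sup>*"
    using rz[of "b1 W"] b1[OF W(1)] W(2) by (meson order_trans)
  have sub1: "Restr F {x \<in> V. blk x \<in> {1..n} - b1 B - b1 W} \<subseteq> Restr F (V - B - W)"
    by (auto simp: b1_def)
  have sub2: "Restr F {x \<in> V. blk x \<in> {1..n} - b1 B} \<subseteq> Restr F (V - B)"
    by (auto simp: b1_def)
  have "card (tip ` Y) \<le> d"
  proof (rule bW)
    show "tip ` Y \<subseteq> V - B - W" using Y(1) tip notin by blast
    show "total_on (tip ` Y) ((Restr F (V - B - W))\<^sup>+)"
    proof (unfold total_on_def, intro ballI impI)
      fix p q assume "p \<in> tip ` Y" "q \<in> tip ` Y" "p \<noteq> q"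
      then obtain x y where xy: "p = tip x" "q = tip y" "x \<in> Y" "y \<in> Y" "x \<noteq> y" by auto
      then have "(x, y) \<in> (Restr E ({1..n} - b1 B - b1 W))\<^sup>+ \<or>
          (y, x) \<in> (Restr E ({1..n} - b1 B - b1 W))\<^sup>+"
        using Y(3) by (auto simp: total_on_def)
      then show "(p, q) \<in> (Restr F (V - B - W))\<^sup>+ \<or> (q, p) \<in> (Restr F (V - B - W))\<^sup>+"
        unfolding xy using lifts_trancl[OF l, of "{1..n} - b1 B - b1 W"] trancl_mono[OF _ sub1]
        by (meson Diff_subset order_trans)
    qed
    show "\<forall>y\<in>tip ` Y. (y, tip z) \<in> (Restr F (V - B))\<^sup>*"
    proof
      fix p assume "p \<in> tip ` Y"
      then obtain y where "y \<in> Y" "p = tip y" by auto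
      then have "(p, tip z) \<in> (Restr F {x \<in> V. blk x \<in> {1..n} - b1 B})\<^sup>*"
        using lifts_rtrancl[OF l, of "{1..n} - b1 B" y z] Y(4) by blast
      then show "(p, tip z) \<in> (Restr F (V - B))\<^sup>*" using rtrancl_mono[OF sub2] by blast
    qed
  qed
  moreover have "inj_on tip Y"
    by (rule inj_on_inverseI[of _ blk]) (use Y(1) tip in blast)
  ultimately show False using Y(2) by (simp add: card_image)
qed

lemma lifts_id:
  assumes "E \<subseteq> {1..n} \<times> {1..n}"
  shows "lifts n E {1..n} E id id"
  using assms unfolding lifts_def by (auto intro!: r_into_trancl)

subsection \<open>The indegree-reduced version\<close>

text \<open>\<open>\<Delta>\<close> may be any bound on the indegree, and \<open>N\<close> may
  exceed \<open>2 * n * \<Delta>\<close>: the extra nodes are isolated padding, which lets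
  \<open>two_indegree_family\<close> reach every number of nodes.\<close>

lemma ir_edges_subset:
  assumes "E \<subseteq> {1..n} \<times> {1..n}" "\<forall>v\<in>{1..n}. card (parents E v) \<le> \<Delta>" "2 * n * \<Delta> \<le> N"
  shows "ir_edges n \<Delta> E \<subseteq> {1..N} \<times> {1..N}"
    and "\<forall>u v. (u, v) \<in> E \<longrightarrow> u < v \<Longrightarrow> \<forall>u v. (u, v) \<in> ir_edges n \<Delta> E \<longrightarrow> u < v"
proof -
  have fin: "finite (parents E v)" for v
    by (rule finite_subset[of _ "{1..n}"]) (use assms(1) in \<open>auto simp: parents_def\<close>)
  have bound: "2 * (v - 1) * \<Delta> + j \<le> 2 * n * \<Delta>" if "v \<in> {1..n}" "j \<le> 2 * \<Delta>" for v j
  proof -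
    have "2 * (v - 1) * \<Delta> + 2 * \<Delta> = 2 * v * \<Delta>" using that by (cases v) auto
    also have "\<dots> \<le> 2 * n * \<Delta>" using that by simp
    finally show ?thesis using that by linarith
  qed
  have par: "sorted_list_of_set (parents E v) ! (i - 1) \<in> parents E v"
    if "i \<in> {1..card (parents E v)}" for v i
  proof -
    have "i - 1 < length (sorted_list_of_set (parents E v))" using that by auto
    then show ?thesis using nth_mem set_sorted_list_of_set[OF fin] by metis
  qed
  show "ir_edges n \<Delta> E \<subseteq> {1..N} \<times> {1..N}"
  proof (clarify)
    fix x y assume "(x, y) \<in> ir_edges n \<Delta> E"
    then consider (chain) v j where "v \<in> {1..n}" "1 \<le> j" "j < 2 * \<Delta>" "x = 2 * (v - 1) * \<Delta> + j" "y = 2 * (v - 1) * \<Delta> + j + 1"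
      | (ext) v i where "v \<in> {1..n}" "i \<in> {1..card (parents E v)}"
        "x = 2 * (sorted_list_of_set (parents E v) ! (i - 1)) * \<Delta>" "y = 2 * (v - 1) * \<Delta> + i"
      unfolding ir_edges_def by blast
    then show "x \<in> {1..N} \<and> y \<in> {1..N}"
    proof cases
      case chain
      then show ?thesis using bound[of v "j + 1"] assms(3) by auto
    next
      case ext
      have "i \<le> \<Delta>" "1 \<le> i" using ext assms(2) by force+
      define u where "u = sorted_list_of_set (parents E v) ! (i - 1)"
      have "u \<in> {1..n}" using par[OF ext(2)] assms(1) by (auto simp: u_def parents_def)
      then have "1 \<le> u * \<Delta>" "u * \<Delta> \<le> n * \<Delta>" using \<open>i \<le> \<Delta>\<close> \<open>1 \<le> i\<close> by auto
      moreover have "x = 2 * (u * \<Delta>)" using ext by (simp add: u_def)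
      moreover have "2 * (n * \<Delta>) \<le> N" using assms(3) by (simp add: mult.assoc)
      ultimately have "x \<in> {1..N}" unfolding atLeastAtMost_iff by linarith
      moreover have "y \<in> {1..N}"
        using bound[OF ext(1), of i] ext assms(3) \<open>i \<le> \<Delta>\<close> \<open>1 \<le> i\<close> by auto
      ultimately show ?thesis ..
    qed
  qed
  show "\<forall>u v. (u, v) \<in> ir_edges n \<Delta> E \<longrightarrow> u < v" if inc: "\<forall>u v. (u, v) \<in> E \<longrightarrow> u < v"
  proof (intro allI impI)
    fix x y assume "(x, y) \<in> ir_edges n \<Delta> E"
    then consider (chain) v j where "x = 2 * (v - 1) * \<Delta> + j" "y = 2 * (v - 1) * \<Delta> + j + 1"
      | (ext) v i where "v \<in> {1..n}" "i \<in> {1..card (parents E v)}"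
        "x = 2 * (sorted_list_of_set (parents E v) ! (i - 1)) * \<Delta>" "y = 2 * (v - 1) * \<Delta> + i"
      unfolding ir_edges_def by blast
    then show "x < y"
    proof cases
      case ext
      have "sorted_list_of_set (parents E v) ! (i - 1) \<le> v - 1"
        using par[OF ext(2)] inc by (fastforce simp: parents_def)
      then have "x \<le> 2 * (v - 1) * \<Delta>" using ext by simp
      then have "x < 2 * (v - 1) * \<Delta> + i" using ext(2) by auto
      then show ?thesis using ext(4) by simp
    qed simp
  qed
qed

text \<open>The gadget of \<open>v\<close> is the chain from
  \<open>2 * (v - 1) * \<Delta> + 1\<close> to its exit \<open>2 * v * \<Delta>\<close>. An edge
  \<open>(u, v)\<close> becomes the external edge from the exit of \<open>u\<close> into this chain,
  followed by the chain up to its end.\<close>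

lemma lifts_ir_edges:
  assumes "E \<subseteq> {1..n} \<times> {1..n}" "\<forall>v\<in>{1..n}. card (parents E v) \<le> \<Delta>" "2 * n * \<Delta> \<le> N" "1 \<le> \<Delta>"
  shows "lifts n E {1..N} (ir_edges n \<Delta> E) (\<lambda>x. (x - 1) div (2 * \<Delta>) + 1) (\<lambda>v. 2 * v * \<Delta>)"
proof -
  define blk where "blk x = (x - 1) div (2 * \<Delta>) + 1" for x
  define node where "node v j = 2 * (v - 1) * \<Delta> + j" for v j
  have node_blk: "blk (node v j) = v" if "v \<in> {1..n}" "1 \<le> j" "j \<le> 2 * \<Delta>" for v j
  proof -
    have "node v j - 1 = (j - 1) + (v - 1) * (2 * \<Delta>)" using that by (simp add: node_def)
    also have "\<dots> div (2 * \<Delta>) = v - 1" using that by (subst div_mult_self1) auto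
    finally show ?thesis using that by (simp add: blk_def)
  qed
  have tip: "node v (2 * \<Delta>) = 2 * v * \<Delta>" if "v \<in> {1..n}" for v
    using that by (cases v) (auto simp: node_def)
  have node_V: "node v j \<in> {1..N}" if "v \<in> {1..n}" "1 \<le> j" "j \<le> 2 * \<Delta>" for v j
  proof -
    have "node v j \<le> 2 * v * \<Delta>" using tip[OF that(1)] that by (simp add: node_def)
    also have "\<dots> \<le> 2 * n * \<Delta>" using that by simp
    finally show ?thesis using that assms(3) by (simp add: node_def)
  qed
  have "(2 * u * \<Delta>, 2 * v * \<Delta>) \<in>
      (Restr (ir_edges n \<Delta> E) {x\<in>{1..N}. x = 2 * u * \<Delta> \<or> blk x = v})\<^sup>+" (is "_ \<in> ?R\<^sup>+")
    if uv: "(u, v) \<in> E" for u v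
  proof -
    have u: "u \<in> {1..n}" and v: "v \<in> {1..n}" using uv assms(1) by auto
    have "finite (parents E v)"
      by (rule finite_subset[of _ "{1..n}"]) (use assms(1) in \<open>auto simp: parents_def\<close>)
    then have "u \<in> set (sorted_list_of_set (parents E v))" using uv by (simp add: parents_def)
    then obtain k where k: "k < card (parents E v)" "sorted_list_of_set (parents E v) ! k = u"
      by (metis in_set_conv_nth length_sorted_list_of_set)
    define i where "i = Suc k"
    have "card (parents E v) \<le> \<Delta>" using assms(2) v by blast
    have i: "1 \<le> i" "i \<le> \<Delta>" "i \<in> {1..card (parents E v)}" "i - 1 = k"
      using k \<open>card (parents E v) \<le> \<Delta>\<close> by (auto simp: i_def)
    have "(2 * u * \<Delta>, node v i) \<in> ir_edges n \<Delta> E"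
      unfolding ir_edges_def node_def using i k v by fastforce
    moreover have "2 * u * \<Delta> \<in> {1..N}"
      using node_V[OF u, of "2 * \<Delta>"] tip[OF u] assms(4) by auto
    ultimately have start: "(2 * u * \<Delta>, node v i) \<in> ?R"
      using node_V[OF v, of i] node_blk[OF v, of i] i by auto
    have "(2 * u * \<Delta>, node v j) \<in> ?R\<^sup>+" if "i \<le> j" "j \<le> 2 * \<Delta>" for j
      using that
    proof (induction j rule: dec_induct)
      case base
      then show ?case using start by blast
    next
      case (step j)
      have "(node v j, node v (Suc j)) \<in> ir_edges n \<Delta> E"
        unfolding ir_edges_def node_def using step v i by fastforce
      then have "(node v j, node v (Suc j)) \<in> ?R"
        using node_V[OF v, of j] node_blk[OF v, of j] node_V[OF v, of "Suc j"]
          node_blk[OF v, of "Suc j"] i step by auto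
      then show ?case using step by (meson Suc_leD trancl.trancl_into_trancl)
    qed
    from this[of "2 * \<Delta>"] show ?thesis using tip[OF v] i by auto
  qed
  moreover have "2 * v * \<Delta> \<in> {1..N} \<and> blk (2 * v * \<Delta>) = v" if "v \<in> {1..n}" for v
    using node_V[OF that, of "2 * \<Delta>"] node_blk[OF that, of "2 * \<Delta>"] tip[OF that] assms(4) by auto
  ultimately show ?thesis unfolding lifts_def blk_def by blast
qed

lemma card_parents_ir_edges:
  assumes "\<forall>v\<in>{1..n}. card (parents E v) \<le> \<Delta>"
  shows "card (parents (ir_edges n \<Delta> E) w) \<le> 2"
proof -
  \<comment> \<open>\<open>w - 1\<close> encodes \<open>v - 1\<close> and \<open>i - 1\<close> as
    quotient and remainder by \<open>2 * \<Delta>\<close>, so \<open>w\<close> receives at most one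
    external edge, and its source can only be \<open>f w\<close>.\<close>
  define f where "f w = 2 * (sorted_list_of_set (parents E ((w - 1) div (2 * \<Delta>) + 1)) ! ((w - 1) mod (2 * \<Delta>))) * \<Delta>" for w
  have "parents (ir_edges n \<Delta> E) w \<subseteq> {w - 1, f w}"
  proof
    fix x assume "x \<in> parents (ir_edges n \<Delta> E) w"
    then consider (chain) v j where "x = 2 * (v - 1) * \<Delta> + j" "w = 2 * (v - 1) * \<Delta> + j + 1"
      | (ext) v i where "v \<in> {1..n}" "i \<in> {1..card (parents E v)}"
        "x = 2 * (sorted_list_of_set (parents E v) ! (i - 1)) * \<Delta>" "w = 2 * (v - 1) * \<Delta> + i"
      unfolding ir_edges_def parents_def by blast
    then show "x \<in> {w - 1, f w}"
    proof cases
      case ext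
      have i: "1 \<le> i" "i \<le> \<Delta>" using ext assms by force+
      then have "w - 1 = (i - 1) + (v - 1) * (2 * \<Delta>)" using ext by simp
      moreover have "((i - 1) + (v - 1) * (2 * \<Delta>)) div (2 * \<Delta>) = v - 1"
        using i by (subst div_mult_self1) auto
      moreover have "((i - 1) + (v - 1) * (2 * \<Delta>)) mod (2 * \<Delta>) = i - 1"
        using i by (subst mod_mult_self1) auto
      ultimately have "(w - 1) div (2 * \<Delta>) = v - 1" "(w - 1) mod (2 * \<Delta>) = i - 1" by simp_all
      moreover have "v - 1 + 1 = v" using ext by simp
      ultimately have "f w = x" unfolding f_def ext(3) by presburger
      then show ?thesis by simp
    qed simp
  qed
  then have "card (parents (ir_edges n \<Delta> E) w) \<le> card {w - 1, f w}" by (intro card_mono) auto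
  also have "\<dots> \<le> 2" by (simp add: card_insert_if)
  finally show ?thesis .
qed

subsection \<open>Depth-robust graphs\<close>

lemma path_trancl:
  assumes "is_path E xs" "set xs \<subseteq> U" "i < j" "j < length xs"
  shows "(xs ! i, xs ! j) \<in> (Restr E U)\<^sup>+"
proof -
  have edge: "(xs ! k, xs ! Suc k) \<in> Restr E U" if "Suc k < length xs" for k
    using assms that by (auto simp: is_path_def intro: nth_mem Suc_lessD)
  have "Suc i \<le> j" using assms by simp
  then show ?thesis using assms(4)
  proof (induction j rule: dec_induct)
    case base
    then show ?case using edge by blast
  next
    case (step k)
    then show ?case using edge[of k] by (meson Suc_lessD trancl.trancl_into_trancl)
  qed
qed

lemma path_increasing:
  assumes "is_path E xs" "\<forall>u v. (u, v) \<in> E \<longrightarrow> u < v" "i < j" "j < length xs"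
  shows "xs ! i < xs ! j"
proof -
  have "(u, v) \<in> (Restr E UNIV)\<^sup>+ \<Longrightarrow> u < v" for u v
    by (induction rule: trancl_induct) (use assms in \<open>auto intro: less_trans\<close>)
  then show ?thesis using path_trancl[of E xs UNIV i j] assms by auto
qed

lemma path_distinct:
  assumes "is_path E xs" "\<forall>u v. (u, v) \<in> E \<longrightarrow> u < v"
  shows "distinct xs"
  unfolding distinct_conv_nth
  using path_increasing[OF assms] by (metis less_irrefl linorder_neqE_nat)

text \<open>Increasing paths repeat no node, so their lengths are bounded by \<open>card V\<close>
  and the supremum is a maximum. Positive depth excludes the empty set of lengths, whose supremum is
  0.\<close>

lemma depth_path:
  assumes "finite V" "\<forall>u v. (u, v) \<in> E \<longrightarrow> u < v" "1 \<le> depth V E"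
  obtains xs where "is_path E xs" "set xs \<subseteq> V" "length xs = depth V E"
proof -
  define L where "L = {length xs | xs. is_path E xs \<and> set xs \<subseteq> V}"
  have "L \<subseteq> {..card V}"
  proof
    fix l assume "l \<in> L"
    then obtain xs where "l = length xs" "is_path E xs" "set xs \<subseteq> V" by (auto simp: L_def)
    then show "l \<in> {..card V}"
      using path_distinct[of E xs] assms distinct_card[of xs] card_mono[of V "set xs"] by auto
  qed
  then have "finite L" using finite_subset by blast
  have "L \<noteq> {}" using assms(3) unfolding depth_def L_def[symmetric] by (auto simp: Sup_nat_def)
  have "Sup L = Max L" using \<open>finite L\<close> \<open>L \<noteq> {}\<close> by (simp add: Sup_nat_def)
  then have "depth V E \<in> L"
    using Max_in[OF \<open>finite L\<close> \<open>L \<noteq> {}\<close>] by (simp add: depth_def L_def[symmetric])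
  then show ?thesis using that unfolding L_def by fastforce
qed

lemma depth_robust_path:
  assumes dr: "\<forall>e d::nat. e + d \<le> N \<longrightarrow> depth_robust {1..n} E e d"
    and inc: "\<forall>u v. (u, v) \<in> E \<longrightarrow> u < v" and S: "S \<subseteq> {1..n}" "card S < N"
  obtains xs where "is_path E xs" "set xs \<subseteq> {1..n} - S" "N - card S \<le> length xs"
proof -
  have "depth_robust {1..n} E (card S) (N - card S)" using dr S by simp
  then have *: "N - card S \<le> depth ({1..n} - S) E" using S by (auto simp: depth_robust_def)
  then have "1 \<le> depth ({1..n} - S) E" using S by linarith
  then obtain xs where "is_path E xs" "set xs \<subseteq> {1..n} - S" "length xs = depth ({1..n} - S) E"
    using depth_path[of "{1..n} - S" E] inc by auto
  then show ?thesis using that * by simp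
qed

text \<open>Depth-robustness is used twice: for a long path \<open>xs\<close> in \<open>G - B\<close>, and, deleting everything
  outside \<open>xs\<close> as well as \<open>W\<close>, for a long path among the nodes of \<open>xs\<close> that avoids \<open>W\<close>.\<close>

lemma depth_robust_chain_robust:
  assumes dr: "\<forall>e d::nat. e + d \<le> N \<longrightarrow> depth_robust {1..n} E e d"
    and inc: "\<forall>u v. (u, v) \<in> E \<longrightarrow> u < v" and b: "b + 2 * d + n < 2 * N"
    and "N \<le> n"
  shows "chain_robust n E b d"
  unfolding chain_robust_def
proof (intro allI impI)
  fix B assume B: "B \<subseteq> {1..n}" "card B \<le> b"
  obtain xs where xs: "is_path E xs" "set xs \<subseteq> {1..n} - B" "N - card B \<le> length xs"
    using depth_robust_path[OF dr inc B(1)] B(2) b \<open>N \<le> n\<close> by auto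
  have "xs \<noteq> []" using xs(1) by (simp add: is_path_def)
  have card_xs: "card (set xs) = length xs"
    using path_distinct[OF xs(1) inc] distinct_card by blast
  show "\<exists>z\<in>{1..n} - B. \<forall>W\<subseteq>{1..n}. card W \<le> d \<longrightarrow>
       (\<exists>Y\<subseteq>{1..n} - B - W. d < card Y \<and> total_on Y ((Restr E ({1..n} - B - W))\<^sup>+) \<and>
          (\<forall>y\<in>Y. (y, z) \<in> (Restr E ({1..n} - B))\<^sup>*))"
  \<comment> \<open>The end of \<open>xs\<close> depends on \<open>B\<close> only, and all of
    \<open>xs\<close> leads to it in \<open>G - B\<close>.\<close>
  proof (intro bexI[of _ "last xs"] allI impI)
    show "last xs \<in> {1..n} - B" using xs(2) last_in_set[OF \<open>xs \<noteq> []\<close>] by blast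
    fix W assume W: "W \<subseteq> {1..n}" "card W \<le> d"
    define S where "S = {1..n} - (set xs - W)"
    have "card (set xs) - card W \<le> card (set xs - W)"
      using diff_card_le_card_Diff[of W "set xs"] finite_subset[OF W(1)] by simp
    moreover have "card S = n - card (set xs - W)"
      unfolding S_def using xs(2) by (subst card_Diff_subset) auto
    moreover have "card (set xs - W) \<le> n"
      using card_mono[of "{1..n}" "set xs - W"] xs(2) by auto
    ultimately have cardS: "card S + N \<le> n + d + card B"
      using W(2) card_xs xs(3) by linarith
    then have "card S < N" using B(2) b by linarith
    then obtain ys where ys: "is_path E ys" "set ys \<subseteq> {1..n} - S" "N - card S \<le> length ys"
      using depth_robust_path[OF dr inc, of S] S_def by auto
    have ys_sub: "set ys \<subseteq> set xs - W" using ys(2) by (auto simp: S_def)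
    show "\<exists>Y\<subseteq>{1..n} - B - W. d < card Y \<and> total_on Y ((Restr E ({1..n} - B - W))\<^sup>+) \<and>
          (\<forall>y\<in>Y. (y, last xs) \<in> (Restr E ({1..n} - B))\<^sup>*)"
    proof (intro exI[of _ "set ys"] conjI ballI)
      show sub: "set ys \<subseteq> {1..n} - B - W" using ys_sub xs(2) by blast
      \<comment> \<open>\<open>N - card S\<close> is at least \<open>2 * N - n - d - card B\<close>,
        which exceeds \<open>d\<close> by the hypothesis on \<open>b\<close>.\<close>
      have "d < N - card S" using cardS B(2) b by linarith
      then show "d < card (set ys)"
        using ys(3) distinct_card[OF path_distinct[OF ys(1) inc]] by linarith
      show "total_on (set ys) ((Restr E ({1..n} - B - W))\<^sup>+)"
      proof (unfold total_on_def, intro ballI impI)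
        fix x y assume "x \<in> set ys" "y \<in> set ys" "x \<noteq> y"
        then obtain i j where "x = ys ! i" "y = ys ! j" "i < length ys" "j < length ys" "i \<noteq> j"
          by (metis in_set_conv_nth)
        then show "(x, y) \<in> (Restr E ({1..n} - B - W))\<^sup>+ \<or> (y, x) \<in> (Restr E ({1..n} - B - W))\<^sup>+"
          using path_trancl[OF ys(1) sub] by (metis linorder_neqE_nat)
      qed
      fix y assume "y \<in> set ys"
      then have "y \<in> set xs" using ys_sub by blast
      then obtain i where i: "i < length xs" "y = xs ! i" by (metis in_set_conv_nth)
      have last: "last xs = xs ! (length xs - 1)" using \<open>xs \<noteq> []\<close> by (rule last_conv_nth)
      show "(y, last xs) \<in> (Restr E ({1..n} - B))\<^sup>*"
      proof (cases "i = length xs - 1")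
        case True
        then show ?thesis using i last by simp
      next
        case False
        then have "(y, last xs) \<in> (Restr E ({1..n} - B))\<^sup>+"
          using path_trancl[OF xs(1,2), of i "length xs - 1"] i last by simp
        then show ?thesis by (rule trancl_into_rtrancl)
      qed
    qed
  qed
qed

text \<open>\<open>b\<close> is the largest value that \<open>depth_robust_chain_robust\<close>
  admits for \<open>d = n div 4\<close>. To leading order \<open>d * b\<close> is \<open>n/4\<close>
  times \<open>n/2 - 2 * \<epsilon> * n\<close>, that is \<open>(1/8 - \<epsilon>/2) * n^2\<close>;
  the spare \<open>n^2/16\<close> absorbs all rounding once \<open>n \<ge> 16\<close>.\<close>

lemma extreme_bound:
  fixes \<epsilon> :: real and n N :: nat
  assumes "0 < \<epsilon>" "\<epsilon> < 1/8" "n \<ge> 16" "N = nat \<lfloor>(1 - \<epsilon>) * real n\<rfloor>"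
  defines "d \<equiv> n div 4" and "b \<equiv> 2 * N - n - 2 * (n div 4) - 1"
  shows "b + 2 * d + n < 2 * N" "(1/16 - \<epsilon>/2) * (real n)^2 \<le> real (d * (b + 1))"
proof -
  have N: "(1 - \<epsilon>) * real n - 1 < real N"
    unfolding assms(4) using assms(1-3) by simp
  have "\<epsilon> * real n \<le> real n / 8" using assms by (simp add: mult_right_mono)
  then have "7 * real n / 8 - 1 < real N" using N by (simp add: algebra_simps)
  moreover have d: "real n / 4 - 3/4 \<le> real d" "real d \<le> real n / 4"
    unfolding d_def by linarith+
  ultimately have "real n + 2 * real d + 1 < 2 * real N" using assms(3) by linarith
  then have "real (n + 2 * d + 1) < real (2 * N)" by simp
  then have lt: "n + 2 * d + 1 < 2 * N" by linarith
  then show "b + 2 * d + n < 2 * N" unfolding b_def d_def by linarith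
  have "real (b + 1) = 2 * real N - real n - 2 * real d"
    using lt unfolding b_def d_def by (simp add: of_nat_diff)
  then have "real (b + 1) \<ge> real n / 2 - 2 - 2 * \<epsilon> * real n"
    using N d by (simp add: algebra_simps)
  then have "real d * real (b + 1) \<ge> real d * (real n / 2 - 2 - 2 * \<epsilon> * real n)"
    by (intro mult_left_mono) auto
  \<comment> \<open>\<open>d\<close> is bounded from below in the positive part and from above in
    the part with \<open>\<epsilon>\<close>, which keeps the coefficient of the latter at exactly
    \<open>\<epsilon>/2\<close>.\<close>
  moreover have "real d * (real n / 2 - 2 - 2 * \<epsilon> * real n)
      \<ge> (real n / 4 - 3/4) * (real n / 2 - 2) - real n / 4 * (2 * \<epsilon> * real n)"
  proof -
    have "(real n / 4 - 3/4) * (real n / 2 - 2) \<le> real d * (real n / 2 - 2)"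
      using d assms(3) by (intro mult_right_mono) auto
    moreover have "real d * (2 * \<epsilon> * real n) \<le> real n / 4 * (2 * \<epsilon> * real n)"
      using d assms(1) by (intro mult_right_mono) auto
    ultimately show ?thesis by (simp add: right_diff_distrib)
  qed
  moreover have "(real n / 4 - 3/4) * (real n / 2 - 2) - real n / 4 * (2 * \<epsilon> * real n)
      \<ge> (1/16 - \<epsilon>/2) * (real n)^2"
  proof -
    have "16 * real n \<le> real n * real n" using assms(3) by (intro mult_right_mono) auto
    then show ?thesis by (simp add: algebra_simps power2_eq_square)
  qed
  ultimately show "(1/16 - \<epsilon>/2) * (real n)^2 \<le> real (d * (b + 1))" by (simp only: of_nat_mult)
qed

subsection \<open>Local expanders\<close>

text \<open>\<open>F c\<close> holds the left neighbours of the right node \<open>c\<close>, both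
  sides being copies of \<open>{..<r}\<close>. The fraction 1/4 is the one that reproduces itself
  from scale to scale in \<open>many_reachable_after\<close>.\<close>

definition bipartite_expander :: "nat \<Rightarrow> (nat \<Rightarrow> nat set) \<Rightarrow> bool" where
  "bipartite_expander r F \<longleftrightarrow> (\<forall>v. finite (F v) \<and> card (F v) \<le> 20) \<and>
    (\<forall>A\<subseteq>{..<r}. \<forall>C\<subseteq>{..<r}. r \<le> 4 * card A \<longrightarrow> r \<le> 4 * card C \<longrightarrow> (\<exists>a\<in>A. \<exists>c\<in>C. a \<in> F c))"

text \<open>For fixed \<open>A\<close> and \<open>C\<close>, at most a fraction \<open>(3/4) ^ (5 * r)\<close> of the maps assigning 20 parents to each
  node gives no edge from \<open>A\<close> to \<open>C\<close>, and \<open>4 * (3/4) ^ 5 < 1\<close> allows a union bound over the \<open>4 ^ r\<close>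
  pairs.\<close>

lemma bipartite_expander_exists:
  fixes r :: nat
  assumes "r \<ge> 1"
  shows "\<exists>F. bipartite_expander r F"
proof -
  define I where "I = {..<r} \<times> {..<20::nat}"
  define Fs where "Fs = I \<rightarrow>\<^sub>E {..<r}"
  define bad where "bad AC = (case AC of (A, C) \<Rightarrow> PiE I (\<lambda>(c, i). if c \<in> C then {..<r} - A else {..<r}))" for AC
  define Q where "Q = {(A, C). A \<subseteq> {..<r} \<and> C \<subseteq> {..<r} \<and> r \<le> 4 * card A \<and> r \<le> 4 * card C}"
  have finI: "finite I" by (simp add: I_def)
  have finFs: "finite Fs" unfolding Fs_def using finI by (intro finite_PiE) auto
  have cardFs: "real (card Fs) = real r ^ (20 * r)"
    unfolding Fs_def using finI by (simp add: card_PiE I_def mult.commute)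
  have Qsub: "Q \<subseteq> Pow {..<r} \<times> Pow {..<r}" by (auto simp: Q_def)
  then have finQ: "finite Q" by (rule finite_subset) auto
  have cardQ: "card Q \<le> 4 ^ r"
  proof -
    have "card Q \<le> card (Pow {..<r} \<times> Pow {..<r})" using Qsub by (intro card_mono) auto
    also have "\<dots> = 2 ^ r * 2 ^ r" by (simp add: card_cartesian_product card_Pow)
    also have "\<dots> = 4 ^ r" by (simp flip: power_mult_distrib)
    finally show ?thesis .
  qed
  have bad_le: "real (card (bad AC)) \<le> real r ^ (20 * r) * (243/1024) ^ r" if ACQ: "AC \<in> Q" for AC
  proof -
    obtain A C where AC: "AC = (A, C)" "A \<subseteq> {..<r}" "C \<subseteq> {..<r}" "r \<le> 4 * card A" "r \<le> 4 * card C"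
      using ACQ by (auto simp: Q_def)
    have finA: "finite A" using AC finite_subset by blast
    have "card A \<le> r" using card_mono[OF _ AC(2)] by simp
    then have A: "real (r - card A) \<le> real r * (3/4)" using AC(4) by (simp add: of_nat_diff)
    have "card (bad AC) = (\<Prod>x\<in>I. card (if fst x \<in> C then {..<r} - A else {..<r}))"
      unfolding bad_def AC(1) using finI by (simp add: card_PiE case_prod_unfold cong: if_cong)
    also have "\<dots> = (\<Prod>(c, i)\<in>I. if c \<in> C then r - card A else r)"
      using AC(2) finA by (intro prod.cong) (auto simp: card_Diff_subset)
    finally have "real (card (bad AC)) = (\<Prod>(c, i)\<in>I. real (if c \<in> C then r - card A else r))"
      by (simp add: of_nat_prod case_prod_unfold)
    also have "\<dots> \<le> (\<Prod>(c, i)\<in>I. real r * (if c \<in> C then 3/4 else 1))"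
      using A by (intro prod_mono) (auto split: if_splits)
    also have "\<dots> = real r ^ (20 * r) * (\<Prod>(c, i)\<in>I. if c \<in> C then 3/4 else 1)"
      by (simp add: case_prod_unfold prod.distrib I_def mult.commute)
    also have "(\<Prod>(c, i)\<in>I. if c \<in> C then 3/4 else (1::real)) = (\<Prod>c<r. \<Prod>i<20::nat. if c \<in> C then 3/4 else 1)"
      unfolding I_def by (rule prod.cartesian_product[symmetric])
    also have "\<dots> = (\<Prod>c<r. if c \<in> C then (3/4) ^ 20 else 1)"
      by (intro prod.cong) auto
    also have "\<dots> = (\<Prod>c\<in>C. (3/4) ^ 20)"
      using AC(3) by (subst prod.inter_restrict[symmetric]) (auto simp: Int_absorb1)
    also have "\<dots> = (3/4) ^ (20 * card C)" by (simp add: power_mult)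
    also have "\<dots> \<le> (3/4 :: real) ^ (5 * r)" using AC(5) by (intro power_decreasing) auto
    also have "\<dots> = (243/1024) ^ r" by (simp add: power_mult power_divide)
    finally show ?thesis by (simp add: mult_left_mono)
  qed
  have "real (card (\<Union>(bad ` Q))) \<le> (\<Sum>AC\<in>Q. real (card (bad AC)))"
    using card_UN_le[OF finQ, of bad] by (metis of_nat_le_iff of_nat_sum)
  also have "\<dots> \<le> (\<Sum>AC\<in>Q. real r ^ (20 * r) * (243/1024) ^ r)" using bad_le by (rule sum_mono)
  also have "\<dots> = real (card Q) * (real r ^ (20 * r) * (243/1024) ^ r)" by simp
  also have "\<dots> \<le> 4 ^ r * (real r ^ (20 * r) * (243/1024) ^ r)"
    using of_nat_mono[OF cardQ, where 'a=real] by (intro mult_right_mono) simp_all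
  also have "\<dots> = real r ^ (20 * r) * (243/256) ^ r"
    using power_mult_distrib[of 4 "243/1024 :: real" r] by simp
  also have "\<dots> < real r ^ (20 * r) * 1"
    using assms by (intro mult_strict_left_mono power_less_one_iff[THEN iffD2]) auto
  finally have "card (\<Union>(bad ` Q)) < card Fs" using cardFs by simp
  then have "\<not> Fs \<subseteq> \<Union>(bad ` Q)"
  proof -
    have "finite (bad AC)" for AC unfolding bad_def using finI
      by (auto simp: case_prod_unfold intro!: finite_PiE)
    then have "finite (\<Union>(bad ` Q))" using finQ by blast
    then show ?thesis using \<open>card (\<Union>(bad ` Q)) < card Fs\<close> card_mono by (metis not_le)
  qed
  then obtain f where f: "f \<in> Fs" "\<And>AC. AC \<in> Q \<Longrightarrow> f \<notin> bad AC" by blast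
  define F where "F c = (\<lambda>i. f (c, i)) ` {..<20::nat}" for c
  have "card (F c) \<le> 20" for c unfolding F_def using card_image_le[of "{..<20::nat}"] by auto
  moreover have "\<exists>a\<in>A. \<exists>c\<in>C. a \<in> F c"
    if AC: "A \<subseteq> {..<r}" "C \<subseteq> {..<r}" "r \<le> 4 * card A" "r \<le> 4 * card C" for A C
  proof (rule ccontr)
    assume no: "\<not> ?thesis"
    have "f \<in> bad (A, C)" unfolding bad_def using f(1) no
      by (auto simp: Fs_def PiE_iff I_def F_def extensional_def)
    then show False using f(2)[of "(A, C)"] AC by (auto simp: Q_def)
  qed
  moreover have "finite (F c)" for c by (simp add: F_def)
  ultimately show ?thesis unfolding bipartite_expander_def by (intro exI[of _ F]) blast
qed

text \<open>\<open>E\<close> lives on all naturals, so that one graph serves every \<open>n\<close>;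
  the blocks are the aligned dyadic intervals of length \<open>2 ^ k\<close>. Distances up to 3 are
  what \<open>good_nodes_connected\<close> needs to join its two blocks.\<close>

definition locally_expanding :: "(nat \<times> nat) set \<Rightarrow> bool" where
  "locally_expanding E \<longleftrightarrow> (\<forall>k p s A C. s \<in> {1..3} \<longrightarrow> A \<subseteq> {x. x div 2 ^ k = p} \<longrightarrow>
     C \<subseteq> {x. x div 2 ^ k = p + s} \<longrightarrow> 2 ^ k \<le> 4 * card A \<longrightarrow> 2 ^ k \<le> 4 * card C \<longrightarrow>
     (\<exists>a\<in>A. \<exists>c\<in>C. (a, c) \<in> E))"

lemma locally_expandingD:
  assumes "locally_expanding E" "A \<subseteq> {x. x div 2 ^ k = p}" "C \<subseteq> {x. x div 2 ^ k = p + s}"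
    "2 ^ k \<le> 4 * card A" "2 ^ k \<le> 4 * card C" "1 \<le> s" "s \<le> 3"
  shows "\<exists>a\<in>A. \<exists>c\<in>C. (a, c) \<in> E"
proof -
  have "s \<in> {1..3}" using assms by simp
  then show ?thesis using assms(1-5) unfolding locally_expanding_def by blast
qed

text \<open>For \<open>n \<ge> 1\<close> this is 1 plus the floor of the binary logarithm of
  \<open>n\<close>.\<close>

definition num_scales :: "nat \<Rightarrow> nat" where
  "num_scales n = card {k. 2 ^ k \<le> n}"

lemma finite_scales: "finite {k. 2 ^ k \<le> (n::nat)}"
proof -
  have "k < n" if "2 ^ k \<le> n" for k using that less_exp[of k] by linarith
  then have "{k. 2 ^ k \<le> n} \<subseteq> {..<n}" by auto
  then show ?thesis by (rule finite_subset) simp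
qed

lemma num_scales_mono: "m \<le> n \<Longrightarrow> num_scales m \<le> num_scales n"
  unfolding num_scales_def by (intro card_mono finite_scales) auto

lemma num_scales_le_log:
  assumes "n \<ge> 1"
  shows "real (num_scales n) \<le> log 2 (real n) + 1"
proof -
  have "k \<le> nat \<lfloor>log 2 (real n)\<rfloor>" if "2 ^ k \<le> n" for k
  proof -
    have "2 ^ k \<le> real n" using that by (metis of_nat_le_iff of_nat_numeral of_nat_power)
    then have "real k \<le> log 2 (real n)" using assms by (simp add: le_log_iff powr_realpow)
    then show ?thesis by linarith
  qed
  then have "{k. 2 ^ k \<le> n} \<subseteq> {..nat \<lfloor>log 2 (real n)\<rfloor>}" by auto
  then have "num_scales n \<le> card {..nat \<lfloor>log 2 (real n)\<rfloor>}"
    unfolding num_scales_def by (intro card_mono) auto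
  moreover have "0 \<le> log 2 (real n)" using assms by simp
  ultimately show ?thesis by simp linarith
qed

text \<open>A copy of the expander is placed between any two dyadic blocks at distance 1 to 3, at
  every scale. The indegree bound counts 3 distances with 20 parents each per scale; scales with
  \<open>2 ^ k > v\<close> contribute nothing, since \<open>v\<close> then lies in the first
  block.\<close>

lemma locally_expanding_exists:
  "\<exists>E. locally_expanding E \<and> (\<forall>u v. (u, v) \<in> E \<longrightarrow> u < v) \<and>
     (\<forall>v. finite (parents E v) \<and> card (parents E v) \<le> 60 * num_scales v)"
proof -
  obtain F where "\<And>r. r \<ge> 1 \<Longrightarrow> bipartite_expander r (F r)"
    using bipartite_expander_exists by metis
  then have F: "\<And>r v. r \<ge> 1 \<Longrightarrow> card (F r v) \<le> 20 \<and> finite (F r v)"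
    and exp: "\<And>r A C. r \<ge> 1 \<Longrightarrow> A \<subseteq> {..<r} \<Longrightarrow> C \<subseteq> {..<r} \<Longrightarrow> r \<le> 4 * card A \<Longrightarrow>
      r \<le> 4 * card C \<Longrightarrow> \<exists>a\<in>A. \<exists>c\<in>C. a \<in> F r c"
    by (simp_all add: bipartite_expander_def)
  define E where "E = {(u, v). \<exists>k s. s \<in> {1..3::nat} \<and> u div 2 ^ k + s = v div 2 ^ k \<and>
      u mod 2 ^ k \<in> F (2 ^ k) (v mod 2 ^ k)}"
  have "locally_expanding E"
    unfolding locally_expanding_def
  proof (intro allI impI)
    fix k p s A C
    assume s: "s \<in> {1..3::nat}" and A: "A \<subseteq> {x. x div 2 ^ k = p}"
      and C: "C \<subseteq> {x. x div 2 ^ k = p + s}"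
      and cA: "2 ^ k \<le> 4 * card A" and cC: "2 ^ k \<le> 4 * card C"
    have inj: "inj_on (\<lambda>x. x mod 2 ^ k) X" if "X \<subseteq> {x. x div 2 ^ k = q}" for X and q :: nat
      by (rule inj_onI) (metis (mono_tags, lifting) div_mult_mod_eq mem_Collect_eq subsetD that)
    have "\<exists>a\<in>(\<lambda>x. x mod 2 ^ k) ` A. \<exists>c\<in>(\<lambda>x. x mod 2 ^ k) ` C. a \<in> F (2 ^ k) c"
      using cA cC card_image[OF inj[OF A]] card_image[OF inj[OF C]] by (intro exp) auto
    then obtain a c where "a \<in> A" "c \<in> C" "a mod 2 ^ k \<in> F (2 ^ k) (c mod 2 ^ k)" by auto
    moreover have "a div 2 ^ k = p" "c div 2 ^ k = p + s" using A C \<open>a \<in> A\<close> \<open>c \<in> C\<close> by blast+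
    ultimately have "(a, c) \<in> E" using s unfolding E_def
      by (intro CollectI case_prodI exI[of _ k] exI[of _ s]) simp
    then show "\<exists>a\<in>A. \<exists>c\<in>C. (a, c) \<in> E" using \<open>a \<in> A\<close> \<open>c \<in> C\<close> by blast
  qed
  moreover have "u < v" if uv: "(u, v) \<in> E" for u v
  proof -
    obtain k s :: nat where "1 \<le> s" "u div 2 ^ k + s = v div 2 ^ k" using uv by (auto simp: E_def)
    then have "u div 2 ^ k < v div 2 ^ k" by linarith
    then show ?thesis using div_le_mono[of v u "2 ^ k"] by linarith
  qed
  moreover have "finite (parents E v) \<and> card (parents E v) \<le> 60 * num_scales v" for v
  proof -
    define G where "G k s = (\<lambda>m. (v div 2 ^ k - s) * 2 ^ k + m) ` F (2 ^ k) (v mod 2 ^ k)" for k s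
    have G: "finite (G k s)" "card (G k s) \<le> 20" for k s
      unfolding G_def using F[of "2 ^ k" "v mod 2 ^ k"] card_image_le[of "F (2 ^ k) (v mod 2 ^ k)"]
      by (auto intro: order_trans)
    have sub: "parents E v \<subseteq> (\<Union>(k, s)\<in>{k. 2 ^ k \<le> v} \<times> {1..3}. G k s)"
    proof
      fix u assume "u \<in> parents E v"
      then obtain k s where ks: "s \<in> {1..3::nat}" "u div 2 ^ k + s = v div 2 ^ k"
        "u mod 2 ^ k \<in> F (2 ^ k) (v mod 2 ^ k)" by (auto simp: E_def parents_def)
      have "v div 2 ^ k \<noteq> 0" using ks by auto
      then have "2 ^ k \<le> v" by (simp add: div_eq_0_iff)
      moreover have "u = (v div 2 ^ k - s) * 2 ^ k + u mod 2 ^ k"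
        using ks(2) by (metis add_diff_cancel_right' div_mult_mod_eq)
      ultimately show "u \<in> (\<Union>(k, s)\<in>{k. 2 ^ k \<le> v} \<times> {1..3}. G k s)"
        using ks unfolding G_def by blast
    qed
    have fin: "finite ({k. 2 ^ k \<le> v} \<times> {1..3::nat})" using finite_scales by simp
    have finU: "finite (\<Union>(k, s)\<in>{k. 2 ^ k \<le> v} \<times> {1..3}. G k s)" using fin G by auto
    have "card (parents E v) \<le> card (\<Union>(k, s)\<in>{k. 2 ^ k \<le> v} \<times> {1..3}. G k s)"
      using sub finU by (rule card_mono[rotated])
    also have "\<dots> \<le> (\<Sum>(k, s)\<in>{k. 2 ^ k \<le> v} \<times> {1..3}. card (G k s))"
      using card_UN_le[OF fin, of "\<lambda>(k, s). G k s"] by (simp add: case_prod_unfold)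
    also have "\<dots> \<le> (\<Sum>(k, s)\<in>{k. 2 ^ k \<le> v} \<times> {1..3::nat}. 20)"
      using G by (intro sum_mono) auto
    also have "\<dots> = 60 * num_scales v" by (simp add: case_prod_unfold num_scales_def card_cartesian_product)
    finally show ?thesis using finite_subset[OF sub finU] by simp
  qed
  ultimately show ?thesis by blast
qed

section \<open>Nodes around which the deleted set is sparse at every scale\<close>

definition sparse_after :: "nat set \<Rightarrow> nat \<Rightarrow> bool" where
  "sparse_after S u \<longleftrightarrow> (\<forall>r. 16 * card (S \<inter> {u..<u + r}) \<le> r)"

text \<open>The window is the interval of length \<open>r\<close> ending at \<open>v\<close>; the
  form \<open>v < x + r\<close> avoids a truncated \<open>v - r\<close>.\<close>

definition sparse_before :: "nat set \<Rightarrow> nat \<Rightarrow> bool" where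
  "sparse_before S v \<longleftrightarrow> (\<forall>r. 16 * card (S \<inter> {x. x \<le> v \<and> v < x + r}) \<le> r)"

text \<open>Greedy covering: the interval witnessing that the least element of \<open>X\<close> is dense has more
  than a sixteenth of its nodes in \<open>S\<close>; remove it and iterate.\<close>

lemma card_not_sparse_after:
  assumes "finite S" "finite X" "\<forall>u\<in>X. \<not> sparse_after S u"
  shows "card X \<le> 16 * card S"
  using assms
proof (induction "card X" arbitrary: X S rule: less_induct)
  case less
  show ?case
  proof (cases "X = {}")
    case False
    define u where "u = Min X"
    have u: "u \<in> X" "\<And>x. x \<in> X \<Longrightarrow> u \<le> x" using False less.prems(2) by (auto simp: u_def)
    obtain r where r: "r < 16 * card (S \<inter> {u..<u + r})"
      using less.prems(3) u(1) unfolding sparse_after_def by (meson not_le)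
    then have "r > 0" by (cases r) auto
    define X' where "X' = X - {u..<u + r}"
    define S' where "S' = S - {u..<u + r}"
    have "\<not> sparse_after S' x" if x: "x \<in> X'" for x
    proof -
      have "u + r \<le> x" using x u by (auto simp: X'_def)
      then have "S' \<inter> {x..<x + q} = S \<inter> {x..<x + q}" for q by (auto simp: S'_def)
      then show ?thesis using less.prems(3) x by (auto simp: sparse_after_def X'_def)
    qed
    moreover have "X' \<subseteq> X" "u \<notin> X'" using \<open>r > 0\<close> by (auto simp: X'_def)
    then have "X' \<subset> X" using u(1) by blast
    then have "card X' < card X" using less.prems(2) by (rule psubset_card_mono[rotated])
    ultimately have "card X' \<le> 16 * card S'"
      using less.prems less.hyps[of X' S'] by (auto simp: X'_def S'_def)
    moreover have "card X \<le> card X' + r"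
    proof -
      have "card X \<le> card (X' \<union> {u..<u + r})" using less.prems by (intro card_mono) (auto simp: X'_def)
      also have "\<dots> \<le> card X' + card {u..<u + r}" by (rule card_Un_le)
      finally show ?thesis by simp
    qed
    moreover have "card S = card S' + card (S \<inter> {u..<u + r})"
      unfolding S'_def using less.prems(1) by (metis add.commute card_Int_Diff)
    ultimately show ?thesis using r by linarith
  qed simp
qed

text \<open>Mirror image of \<open>card_not_sparse_after\<close>: the covering starts from the
  greatest element and moves down.\<close>

lemma card_not_sparse_before:
  assumes "finite S" "finite X" "\<forall>u\<in>X. \<not> sparse_before S u"
  shows "card X \<le> 16 * card S"
  using assms
proof (induction "card X" arbitrary: X S rule: less_induct)
  case less
  show ?case
  proof (cases "X = {}")
    case False
    define v where "v = Max X"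
    have v: "v \<in> X" "\<And>x. x \<in> X \<Longrightarrow> x \<le> v" using False less.prems(2) by (auto simp: v_def)
    define I where "I r = {x. x \<le> v \<and> v < x + r}" for r
    obtain r where r: "r < 16 * card (S \<inter> I r)"
      using less.prems(3) v(1) unfolding sparse_before_def I_def by (meson not_le)
    moreover have "I 0 = {}" by (auto simp: I_def)
    ultimately have "r > 0" by (cases r) auto
    have "I r \<subseteq> {v + 1 - r..<v + 1}" by (auto simp: I_def)
    then have I: "finite (I r)" "card (I r) \<le> r"
      using card_mono[of "{v + 1 - r..<v + 1}" "I r"] finite_subset[of "I r"] by auto
    define X' where "X' = X - I r"
    define S' where "S' = S - I r"
    have "\<not> sparse_before S' x" if x: "x \<in> X'" for x
    proof -
      have "x + r \<le> v" using x v by (auto simp: X'_def I_def)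
      then have "S' \<inter> {y. y \<le> x \<and> x < y + q} = S \<inter> {y. y \<le> x \<and> x < y + q}" for q
        by (auto simp: S'_def I_def)
      then show ?thesis using less.prems(3) x by (auto simp: sparse_before_def X'_def)
    qed
    moreover have "X' \<subseteq> X" "v \<notin> X'" using \<open>r > 0\<close> by (auto simp: X'_def I_def)
    then have "X' \<subset> X" using v(1) by blast
    then have "card X' < card X" using less.prems(2) by (rule psubset_card_mono[rotated])
    ultimately have "card X' \<le> 16 * card S'"
      using less.prems less.hyps[of X' S'] by (auto simp: X'_def S'_def)
    moreover have "card X \<le> card X' + r"
    proof -
      have "card X \<le> card (X' \<union> I r)" using less.prems I by (intro card_mono) (auto simp: X'_def)
      also have "\<dots> \<le> card X' + card (I r)" by (rule card_Un_le)
      finally show ?thesis using I by simp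
    qed
    moreover have "card S = card S' + card (S \<inter> I r)"
      unfolding S'_def using less.prems(1) by (metis add.commute card_Int_Diff)
    ultimately show ?thesis using r by linarith
  qed simp
qed

definition good_nodes :: "nat \<Rightarrow> nat set \<Rightarrow> nat set" where
  "good_nodes n S = {x\<in>{1..n}. sparse_after S x \<and> sparse_before S x}"

lemma card_good_nodes:
  assumes "finite S"
  shows "n \<le> card (good_nodes n S) + 32 * card S"
proof -
  define X where "X = {x\<in>{1..n}. \<not> sparse_after S x}"
  define Y where "Y = {x\<in>{1..n}. \<not> sparse_before S x}"
  have "card X \<le> 16 * card S" by (rule card_not_sparse_after[OF assms]) (simp_all add: X_def)
  moreover have "card Y \<le> 16 * card S"
    by (rule card_not_sparse_before[OF assms]) (simp_all add: Y_def)
  moreover have "{1..n} = good_nodes n S \<union> X \<union> Y" by (auto simp: good_nodes_def X_def Y_def)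
  then have "card (good_nodes n S \<union> X \<union> Y) = n" by (metis card_atLeastAtMost diff_Suc_1)
  moreover have "card (good_nodes n S \<union> X \<union> Y) \<le> card (good_nodes n S) + card X + card Y"
    using card_Un_le[of "good_nodes n S \<union> X" Y] card_Un_le[of "good_nodes n S" X] by linarith
  ultimately show ?thesis by linarith
qed

text \<open>With density at most 1/16, a window of fewer than 16 nodes cannot meet \<open>S\<close>
  at all. This starts the induction in \<open>many_reachable_after\<close>.\<close>

lemma sparse_after_notin:
  assumes "sparse_after S u" "finite S" shows "u \<notin> S" "Suc u \<notin> S"
proof -
  have "16 * card (S \<inter> {u..<u + 2}) \<le> 2" using assms(1) unfolding sparse_after_def by blast
  then have "card (S \<inter> {u..<u + 2}) = 0" by linarith
  then have "S \<inter> {u..<u + 2} = {}" using assms(2) by (metis card_0_eq finite_Int)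
  then show "u \<notin> S" "Suc u \<notin> S" by auto
qed

lemma sparse_before_notin:
  assumes "sparse_before S v" "finite S" "1 \<le> v" shows "v \<notin> S" "v - 1 \<notin> S"
proof -
  have "16 * card (S \<inter> {x. x \<le> v \<and> v < x + 2}) \<le> 2"
    using assms(1) unfolding sparse_before_def by blast
  then have "card (S \<inter> {x. x \<le> v \<and> v < x + 2}) = 0" by linarith
  then have "S \<inter> {x. x \<le> v \<and> v < x + 2} = {}" using assms(2) by (metis card_0_eq finite_Int)
  then show "v \<notin> S" "v - 1 \<notin> S" using assms(3) by auto
qed

section \<open>Paths between good nodes\<close>

lemma div_eq_iff_block: "0 < r \<Longrightarrow> x div r = p \<longleftrightarrow> p * r \<le> x \<and> x < p * r + (r::nat)"
  using less_eq_div_iff_mult_less_eq[of r p x] div_less_iff_less_mult[of r x "Suc p"]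
  unfolding mult_Suc by linarith

lemma card_block: "card {x. x div 2 ^ k = (p::nat)} = 2 ^ k" "finite {x. x div 2 ^ k = (p::nat)}"
proof -
  have "{x. x div 2 ^ k = p} = {p * 2 ^ k..<p * 2 ^ k + 2 ^ k}"
    unfolding div_eq_iff_block[OF zero_less_power[OF zero_less_numeral]]
    by (simp add: atLeastLessThan_def atLeast_def lessThan_def Collect_conj_eq)
  then show "card {x. x div 2 ^ k = p} = 2 ^ k" "finite {x. x div 2 ^ k = p}" by auto
qed

lemma div_power_Suc: "x div 2 ^ Suc k = x div 2 ^ k div (2::nat)"
  unfolding power_Suc2 by (rule div_mult2_eq)

text \<open>At scale 0 the blocks are single nodes, so expansion yields the edges
  themselves.\<close>

lemma locally_expanding_edge:
  assumes "locally_expanding E" "u < v" "v \<le> u + 3"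
  shows "(u, v) \<in> E"
  using locally_expandingD[OF assms(1), of "{u}" 0 u "{v}" "v - u"] assms(2,3) by auto

text \<open>Induction over the scales: a quarter of the block following that of \<open>u\<close> is
  reachable, and by expansion it has edges to all but a quarter of the nodes outside
  \<open>S\<close> in the block after it. The hypothesis on \<open>v\<close> keeps these blocks
  below \<open>v\<close>, hence inside \<open>[n]\<close>.\<close>

lemma many_reachable_after:
  assumes E: "locally_expanding E" and S: "finite S" "sparse_after S u"
    and uv: "1 \<le> u" "v \<le> n" and k: "u div 2 ^ k + 1 < v div 2 ^ k"
  shows "2 ^ k \<le> 4 * card {x. x div 2 ^ k = u div 2 ^ k + 1 \<and> (u, x) \<in> (Restr E ({1..n} - S))\<^sup>*}"
  using k
proof (induction k)
  case 0
  have "(u, u + 1) \<in> Restr E ({1..n} - S)"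
    using locally_expanding_edge[OF E, of u "u + 1"] sparse_after_notin[OF S(2,1)] 0 uv by auto
  then have "{x. x div 2 ^ 0 = u div 2 ^ 0 + 1 \<and> (u, x) \<in> (Restr E ({1..n} - S))\<^sup>*} = {u + 1}"
    by auto
  then show ?case by simp
next
  case (Suc k)
  define r :: nat where "r = 2 ^ k"
  define b where "b = u div r"
  have "r > 0" by (simp add: r_def)
  have div2: "x div 2 ^ Suc k = x div r div 2" for x
    unfolding r_def by (rule div_power_Suc)
  have b: "b div 2 + 1 < v div r div 2" using Suc.prems unfolding div2 b_def .
  then have bv: "b + 2 < v div r" by linarith
  define A where "A = {x. x div r = b + 1 \<and> (u, x) \<in> (Restr E ({1..n} - S))\<^sup>*}"
  \<comment> \<open>Whatever the parity of \<open>b\<close>, block \<open>b + 2\<close> is one half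
    of the block following that of \<open>u\<close> at scale \<open>Suc k\<close>.\<close>
  define D where "D = {x. x div r = b + 2}"
  define C where "C = {x\<in>D - S. \<forall>a\<in>A. (a, x) \<notin> E}"
  have A: "r \<le> 4 * card A" using Suc.IH bv by (simp add: A_def r_def b_def)
  have D: "card D = r" "finite D" using card_block[of k "b + 2"] by (auto simp: D_def r_def)
  have C: "4 * card C < r"
  proof (rule ccontr)
    assume "\<not> ?thesis"
    then have "\<exists>a\<in>A. \<exists>c\<in>C. (a, c) \<in> E"
      using A by (intro locally_expandingD[OF E, of A k "b + 1" C 1])
        (auto simp: A_def C_def D_def r_def)
    then show False by (auto simp: C_def)
  qed
  have "D \<subseteq> {u..<u + 3 * r}"
  proof
    fix x assume "x \<in> D"
    then have x: "x div r = b + 2" by (simp add: D_def)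
    have "x < (b + 3) * r" using div_eq_iff_block[OF \<open>r > 0\<close>, of x "b + 2"] x
      by (simp add: algebra_simps)
    moreover have "b * r \<le> u" by (simp add: b_def)
    moreover have "u < x" using div_le_mono[of x u r] x by (auto simp: b_def not_le[symmetric])
    ultimately show "x \<in> {u..<u + 3 * r}" by (simp add: add_mult_distrib)
  qed
  then have "card (S \<inter> D) \<le> card (S \<inter> {u..<u + 3 * r})" using S by (intro card_mono) auto
  moreover have "16 * card (S \<inter> {u..<u + 3 * r}) \<le> 3 * r"
    using S(2) unfolding sparse_after_def by blast
  ultimately have SD: "16 * card (S \<inter> D) \<le> 3 * r" by linarith
  have "D - S - C \<subseteq> {x. x div 2 ^ Suc k = u div 2 ^ Suc k + 1 \<and> (u, x) \<in> (Restr E ({1..n} - S))\<^sup>*}"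
  proof
    fix x assume x: "x \<in> D - S - C"
    then obtain a where a: "a \<in> A" "(a, x) \<in> E" by (auto simp: C_def)
    have xr: "x div r = b + 2" using x by (simp add: D_def)
    have "x < v" using div_le_mono[of v x r] bv xr by (auto simp: not_le[symmetric])
    have "a > u" using div_le_mono[of a u r] a by (auto simp: A_def b_def not_le[symmetric])
    have "x > u" using div_le_mono[of x u r] xr by (auto simp: b_def not_le[symmetric])
    have ua: "(u, a) \<in> (Restr E ({1..n} - S))\<^sup>*" using a by (simp add: A_def)
    then have "a \<in> {1..n} - S" using \<open>a > u\<close> by (auto elim: rtranclE)
    then have "(u, x) \<in> (Restr E ({1..n} - S))\<^sup>*"
      using ua a x \<open>x > u\<close> \<open>x < v\<close> uv by (intro rtrancl_into_rtrancl[OF ua]) auto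
    moreover have "x div 2 ^ Suc k = u div 2 ^ Suc k + 1" unfolding div2 xr by (simp add: b_def)
    ultimately show "x \<in> {x. x div 2 ^ Suc k = u div 2 ^ Suc k + 1 \<and> (u, x) \<in> (Restr E ({1..n} - S))\<^sup>*}"
      by blast
  qed
  then have "card (D - S - C) \<le> card {x. x div 2 ^ Suc k = u div 2 ^ Suc k + 1 \<and> (u, x) \<in> (Restr E ({1..n} - S))\<^sup>*}"
    using card_block(2)[of "Suc k" "u div 2 ^ Suc k + 1"]
    by (intro card_mono) (auto intro: finite_subset)
  moreover have "r \<le> card (D - S - C) + card (S \<inter> D) + card C"
  proof -
    have "D \<subseteq> (D - S - C) \<union> (S \<inter> D) \<union> C" by auto
    then have "card D \<le> card ((D - S - C) \<union> (S \<inter> D) \<union> C)"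
      using D S by (intro card_mono) (auto simp: C_def)
    also have "\<dots> \<le> card (D - S - C) + card (S \<inter> D) + card C"
      by (meson add_le_mono card_Un_le le_refl order_trans)
    finally show ?thesis using D by simp
  qed
  \<comment> \<open>Losing fewer than \<open>r/4\<close> nodes to \<open>C\<close> and at most
    \<open>3 * r/16\<close> to \<open>S\<close> leaves more than \<open>r/2\<close>, a quarter of a
    block of length \<open>2 * r\<close>. Here the density 1/16 pays off.\<close>
  ultimately show ?case using C SD by (simp add: r_def)
qed

text \<open>Mirror image of \<open>many_reachable_after\<close>, for the block preceding that of
  \<open>v\<close>; writing \<open>+ 1\<close> on the left avoids a truncated subtraction.\<close>

lemma many_reachable_before:
  assumes E: "locally_expanding E" and S: "finite S" "sparse_before S v"
    and uv: "1 \<le> u" "v \<le> n" and k: "u div 2 ^ k + 1 < v div 2 ^ k"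
  shows "2 ^ k \<le> 4 * card {x. x div 2 ^ k + 1 = v div 2 ^ k \<and> (x, v) \<in> (Restr E ({1..n} - S))\<^sup>*}"
  using k
proof (induction k)
  case 0
  have "(v - 1, v) \<in> Restr E ({1..n} - S)"
    using locally_expanding_edge[OF E, of "v - 1" v] sparse_before_notin[OF S(2,1)] 0 uv by auto
  then have "{x. x div 2 ^ 0 + 1 = v div 2 ^ 0 \<and> (x, v) \<in> (Restr E ({1..n} - S))\<^sup>*} = {v - 1}"
    using 0 by auto
  then show ?case by simp
next
  case (Suc k)
  define r :: nat where "r = 2 ^ k"
  define c where "c = v div r"
  have "r > 0" by (simp add: r_def)
  have div2: "x div 2 ^ Suc k = x div r div 2" for x
    unfolding r_def by (rule div_power_Suc)
  have "u div r div 2 + 1 < c div 2" using Suc.prems unfolding div2 c_def .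
  then have uc: "u div r + 2 < c" by linarith
  define A where "A = {x. x div r + 1 = c \<and> (x, v) \<in> (Restr E ({1..n} - S))\<^sup>*}"
  define D where "D = {x. x div r = c - 2}"
  define C where "C = {x\<in>D - S. \<forall>a\<in>A. (x, a) \<notin> E}"
  have A: "r \<le> 4 * card A" using Suc.IH uc by (simp add: A_def r_def c_def)
  have D: "card D = r" "finite D" using card_block[of k "c - 2"] by (auto simp: D_def r_def)
  have C: "4 * card C < r"
  proof (rule ccontr)
    assume "\<not> ?thesis"
    then have "\<exists>a\<in>C. \<exists>c\<in>A. (a, c) \<in> E"
      using A uc by (intro locally_expandingD[OF E, of C k "c - 2" A 1])
        (auto simp: A_def C_def D_def r_def)
    then show False by (auto simp: C_def)
  qed
  have D_iv: "D \<subseteq> {x. x \<le> v \<and> v < x + 3 * r}"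
  proof
    fix x assume "x \<in> D"
    then have x: "x div r + 2 = c" using uc by (simp add: D_def)
    have "v < (c + 1) * r" using div_eq_iff_block[OF \<open>r > 0\<close>, of v c] c_def
      by (simp add: algebra_simps)
    moreover have "x div r * r \<le> x" by simp
    moreover have "(c + 1) * r = x div r * r + 3 * r" unfolding x[symmetric] by (simp add: algebra_simps)
    moreover have "x < v" using div_le_mono[of v x r] x by (auto simp: c_def not_le[symmetric])
    ultimately show "x \<in> {x. x \<le> v \<and> v < x + 3 * r}" by (simp only: mem_Collect_eq) linarith
  qed
  then have "card (S \<inter> D) \<le> card (S \<inter> {x. x \<le> v \<and> v < x + 3 * r})"
    using S by (intro card_mono) auto
  moreover have "16 * card (S \<inter> {x. x \<le> v \<and> v < x + 3 * r}) \<le> 3 * r"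
    using S(2) unfolding sparse_before_def by blast
  ultimately have SD: "16 * card (S \<inter> D) \<le> 3 * r" by linarith
  have "D - S - C \<subseteq> {x. x div 2 ^ Suc k + 1 = v div 2 ^ Suc k \<and> (x, v) \<in> (Restr E ({1..n} - S))\<^sup>*}"
  proof
    fix x assume x: "x \<in> D - S - C"
    then obtain a where a: "a \<in> A" "(x, a) \<in> E" by (auto simp: C_def)
    have xr: "x div r + 2 = c" using x uc by (simp add: D_def)
    have "a < v" using div_le_mono[of v a r] a by (auto simp: A_def c_def not_le[symmetric])
    have "x < v" using div_le_mono[of v x r] xr by (auto simp: c_def not_le[symmetric])
    have "x > u" using div_le_mono[of x u r] xr uc by (auto simp: not_le[symmetric])
    have av: "(a, v) \<in> (Restr E ({1..n} - S))\<^sup>*" using a by (simp add: A_def)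
    then have "a \<in> {1..n} - S" using \<open>a < v\<close> by (auto elim: converse_rtranclE)
    then have "(x, v) \<in> (Restr E ({1..n} - S))\<^sup>*"
      using av a x \<open>x > u\<close> \<open>x < v\<close> uv by (intro converse_rtrancl_into_rtrancl[OF _ av]) auto
    moreover have "x div 2 ^ Suc k + 1 = v div 2 ^ Suc k" unfolding div2 c_def[symmetric] xr[symmetric] by simp
    ultimately show "x \<in> {x. x div 2 ^ Suc k + 1 = v div 2 ^ Suc k \<and> (x, v) \<in> (Restr E ({1..n} - S))\<^sup>*}"
      by blast
  qed
  moreover have "finite {x. x div 2 ^ Suc k + 1 = v div 2 ^ Suc k \<and> (x, v) \<in> (Restr E ({1..n} - S))\<^sup>*}"
    using card_block(2)[of "Suc k" "v div 2 ^ Suc k - 1"] by (rule finite_subset[rotated]) auto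
  ultimately have "card (D - S - C) \<le> card {x. x div 2 ^ Suc k + 1 = v div 2 ^ Suc k \<and> (x, v) \<in> (Restr E ({1..n} - S))\<^sup>*}"
    by (intro card_mono)
  moreover have "r \<le> card (D - S - C) + card (S \<inter> D) + card C"
  proof -
    have "D \<subseteq> (D - S - C) \<union> (S \<inter> D) \<union> C" by auto
    then have "card D \<le> card ((D - S - C) \<union> (S \<inter> D) \<union> C)"
      using D S by (intro card_mono) (auto simp: C_def)
    also have "\<dots> \<le> card (D - S - C) + card (S \<inter> D) + card C"
      by (meson add_le_mono card_Un_le le_refl order_trans)
    finally show ?thesis using D by simp
  qed
  ultimately show ?case using C SD by (simp add: r_def)
qed

text \<open>Take a scale at which the blocks of \<open>u\<close> and \<open>v\<close> are at least 3
  apart, but no longer so at the next scale. Then they are at most 5 apart, so the block after that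
  of \<open>u\<close> and the block before that of \<open>v\<close> are at distance 1 to 3, and
  expansion joins a node reachable from \<open>u\<close> to one that reaches
  \<open>v\<close>.\<close>

lemma good_nodes_connected:
  assumes E: "locally_expanding E" and S: "finite S"
    and uv: "u \<in> good_nodes n S" "v \<in> good_nodes n S" "u < v"
  shows "(u, v) \<in> (Restr E ({1..n} - S))\<^sup>+"
proof -
  have u: "1 \<le> u" "u \<le> n" "sparse_after S u" "u \<notin> S"
    using uv(1) sparse_after_notin[of S u] S by (auto simp: good_nodes_def)
  have v: "1 \<le> v" "v \<le> n" "sparse_before S v" "v \<notin> S"
    using uv(2) sparse_before_notin[of S v] S by (auto simp: good_nodes_def)
  have "(u, v) \<in> (Restr E ({1..n} - S))\<^sup>*"
  proof (cases "v \<le> u + 3")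
    case True
    then show ?thesis using locally_expanding_edge[OF E uv(3)] u v by auto
  next
    case False
    define far where "far k \<longleftrightarrow> u div 2 ^ k + 3 \<le> v div 2 ^ k" for k
    have "far 0" using False by (simp add: far_def)
    moreover have "\<not> far v" by (simp add: far_def)
    ultimately obtain k where k: "far k" "\<not> far (Suc k)"
      using nat_switch_on[of "\<lambda>k. \<not> far k" v 0] by auto
    define b where "b = u div 2 ^ k"
    define c where "c = v div 2 ^ k"
    have bc: "b + 3 \<le> c" "\<not> b div 2 + 3 \<le> c div 2"
      using k unfolding far_def b_def c_def div_power_Suc by auto
    define A where "A = {x. x div 2 ^ k = b + 1 \<and> (u, x) \<in> (Restr E ({1..n} - S))\<^sup>*}"
    define C where "C = {x. x div 2 ^ k + 1 = c \<and> (x, v) \<in> (Restr E ({1..n} - S))\<^sup>*}"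
    have "2 ^ k \<le> 4 * card A" unfolding A_def b_def
      by (rule many_reachable_after[OF E S u(3,1) v(2)]) (use bc in \<open>simp add: b_def c_def\<close>)
    moreover have "2 ^ k \<le> 4 * card C" unfolding C_def c_def
      by (rule many_reachable_before[OF E S v(3) u(1) v(2)]) (use bc in \<open>simp add: b_def c_def\<close>)
    moreover have "1 \<le> c - b - 2" "c - b - 2 \<le> 3" using bc by linarith+
    ultimately have "\<exists>a\<in>A. \<exists>x\<in>C. (a, x) \<in> E"
      using bc by (intro locally_expandingD[OF E, of A k "b + 1" C "c - b - 2"])
        (auto simp: A_def C_def)
    then obtain a x where ax: "a \<in> A" "x \<in> C" "(a, x) \<in> E" by blast
    have "a \<noteq> u" using ax(1) by (auto simp: A_def b_def)
    have "x \<noteq> v" using ax(2) by (auto simp: C_def c_def)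
    have ua: "(u, a) \<in> (Restr E ({1..n} - S))\<^sup>*" and xv: "(x, v) \<in> (Restr E ({1..n} - S))\<^sup>*"
      using ax by (auto simp: A_def C_def)
    have "a \<in> {1..n} - S" using ua \<open>a \<noteq> u\<close> by (auto elim: rtranclE)
    moreover have "x \<in> {1..n} - S" using xv \<open>x \<noteq> v\<close> by (auto elim: converse_rtranclE)
    ultimately have "(a, x) \<in> Restr E ({1..n} - S)" using ax(3) by blast
    then show ?thesis using ua xv by (meson rtrancl_trans converse_rtrancl_into_rtrancl)
  qed
  then show ?thesis using uv(3) by (auto simp: rtrancl_eq_or_trancl)
qed

text \<open>\<open>z\<close> is the last good node for \<open>B\<close>. More than \<open>d\<close>
  nodes are good for \<open>B \<union> W\<close>; they are pairwise connected avoiding that set.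
  They are also good for the smaller set \<open>B\<close>, hence connected to \<open>z\<close> in
  \<open>G - B\<close>.\<close>

lemma locally_expanding_chain_robust:
  assumes E: "locally_expanding E" and bd: "32 * (b + d) + d < n"
  shows "chain_robust n (E \<inter> {1..n} \<times> {1..n}) b d"
  unfolding chain_robust_def
proof (intro allI impI)
  fix B assume B: "B \<subseteq> {1..n}" "card B \<le> b"
  have finB: "finite B" using B finite_subset by blast
  have Restr_eq: "Restr (E \<inter> {1..n} \<times> {1..n}) ({1..n} - X) = Restr E ({1..n} - X)" for X by auto
  have fin: "finite (good_nodes n X)" for X by (simp add: good_nodes_def)
  have "good_nodes n B \<noteq> {}" using card_good_nodes[OF finB, of n] B(2) bd by auto
  define z where "z = Max (good_nodes n B)"
  have z: "z \<in> good_nodes n B" "\<And>y. y \<in> good_nodes n B \<Longrightarrow> y \<le> z"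
    using \<open>good_nodes n B \<noteq> {}\<close> fin by (auto simp: z_def)
  have good_notin: "good_nodes n X \<subseteq> {1..n} - X" if "finite X" for X
    using sparse_after_notin that by (auto simp: good_nodes_def)
  show "\<exists>z\<in>{1..n} - B. \<forall>W\<subseteq>{1..n}. card W \<le> d \<longrightarrow>
       (\<exists>Y\<subseteq>{1..n} - B - W. d < card Y \<and>
          total_on Y ((Restr (E \<inter> {1..n} \<times> {1..n}) ({1..n} - B - W))\<^sup>+) \<and>
          (\<forall>y\<in>Y. (y, z) \<in> (Restr (E \<inter> {1..n} \<times> {1..n}) ({1..n} - B))\<^sup>*))"
  proof (intro bexI[of _ z] allI impI)
    show "z \<in> {1..n} - B" using z good_notin[OF finB] by blast
    fix W assume W: "W \<subseteq> {1..n}" "card W \<le> d"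
    have finBW: "finite (B \<union> W)" using finB W finite_subset by blast
    define Y where "Y = good_nodes n (B \<union> W)"
    have DW: "{1..n} - B - W = {1..n} - (B \<union> W)" by blast
    have "card (B \<union> W) \<le> b + d" using card_Un_le[of B W] B W by linarith
    then have "32 * card (B \<union> W) \<le> 32 * (b + d)" by (rule mult_le_mono2)
    then have "32 * card (B \<union> W) + d < n" using bd by (rule order_le_less_trans[OF add_right_mono])
    then have "d < card Y" using card_good_nodes[OF finBW, of n] unfolding Y_def by linarith
    moreover have "Y \<subseteq> {1..n} - B - W" using good_notin[OF finBW] unfolding Y_def by blast
    moreover have "total_on Y ((Restr E ({1..n} - (B \<union> W)))\<^sup>+)"
      unfolding total_on_def Y_def using good_nodes_connected[OF E finBW, of _ n]
      by (metis linorder_neqE_nat)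
    moreover have "(y, z) \<in> (Restr E ({1..n} - B))\<^sup>*" if "y \<in> Y" for y
    proof -
      have mono: "16 * card (B \<inter> I) \<le> r" if "16 * card ((B \<union> W) \<inter> I) \<le> r" for I r
        using that card_mono[of "(B \<union> W) \<inter> I" "B \<inter> I"] finBW by fastforce
      have "y \<in> good_nodes n B"
        using that mono unfolding Y_def good_nodes_def sparse_after_def sparse_before_def by blast
      then have "y = z \<or> (y, z) \<in> (Restr E ({1..n} - B))\<^sup>+"
        using z good_nodes_connected[OF E finB, of y n z] by (metis le_neq_implies_less)
      then show ?thesis by auto
    qed
    ultimately show "\<exists>Y\<subseteq>{1..n} - B - W. d < card Y \<and>
          total_on Y ((Restr (E \<inter> {1..n} \<times> {1..n}) ({1..n} - B - W))\<^sup>+) \<and>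
          (\<forall>y\<in>Y. (y, z) \<in> (Restr (E \<inter> {1..n} \<times> {1..n}) ({1..n} - B))\<^sup>*)"
      unfolding DW Restr_eq by blast
  qed
qed

subsection \<open>Lower bounds\<close>

lemma card_parents_le_max_indeg:
  assumes "finite V" "v \<in> V"
  shows "card (parents E v) \<le> max_indeg V E"
  unfolding max_indeg_def using assms by (intro Max_ge) auto

lemma max_indeg_le:
  assumes "finite V" "\<And>v. v \<in> V \<Longrightarrow> card (parents E v) \<le> k"
  shows "max_indeg V E \<le> k"
  unfolding max_indeg_def using assms by (subst Max_le_iff) auto

text \<open>Stated for any graph that lifts \<open>G\<close>, so that it yields both bounds of the
  theorem.\<close>

lemma extreme_depth_robust_lift_bound:
  fixes \<epsilon> :: real
  assumes \<epsilon>: "0 < \<epsilon>" "\<epsilon> < 1" and inc: "\<forall>u v. (u, v) \<in> E \<longrightarrow> u < v"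
    and dr: "\<forall>e d::nat. real (e + d) \<le> (1 - \<epsilon>) * real n \<longrightarrow> depth_robust {1..n} E e d"
    and l: "lifts n E {1..N} F blk tip" and "n \<le> N"
    and F: "F \<subseteq> {1..N} \<times> {1..N}" "\<forall>u v. (u, v) \<in> F \<longrightarrow> u < v"
  shows "(1/16 - \<epsilon>/2) * (real n)^2 \<le> real (Pi_bw_cc {1..N} F)"
proof -
  \<comment> \<open>For \<open>\<epsilon> \<ge> 1/8\<close> the bound is not positive, and for
    \<open>n < 16\<close> it is at most the number of nodes.\<close>
  consider "\<epsilon> \<ge> 1/8" | "n < 16" | "\<epsilon> < 1/8" "n \<ge> 16" by linarith
  then show ?thesis
  proof cases
    case 1
    then have "(1/16 - \<epsilon>/2) * (real n)^2 \<le> 0" by (intro mult_nonpos_nonneg) auto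
    then show ?thesis by (rule order_trans) simp
  next
    case 2
    have "(1/16 - \<epsilon>/2) * (real n)^2 \<le> 1/16 * (real n)^2" using \<epsilon> by (intro mult_right_mono) auto
    also have "\<dots> \<le> real n"
      using 2 mult_right_mono[of "real n" 16 "real n"] by (simp add: power2_eq_square)
    also have "\<dots> \<le> real (card {1..N})" using \<open>n \<le> N\<close> by simp
    also have "\<dots> \<le> real (Pi_bw_cc {1..N} F)" using Pi_bw_cc_ge_card[of "{1..N}" F] F by simp
    finally show ?thesis .
  next
    case 3
    define M where "M = nat \<lfloor>(1 - \<epsilon>) * real n\<rfloor>"
    define d where "d = n div 4"
    define b where "b = 2 * M - n - 2 * (n div 4) - 1"
    note bd = extreme_bound[OF \<epsilon>(1) 3 M_def, folded d_def, folded b_def[unfolded d_def[symmetric]]]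
    have M: "real M \<le> (1 - \<epsilon>) * real n" using \<epsilon> by (simp add: M_def)
    have "(1 - \<epsilon>) * real n \<le> 1 * real n" using \<epsilon> by (intro mult_right_mono) auto
    then have "M \<le> n" using M by simp
    have "\<forall>e d::nat. e + d \<le> M \<longrightarrow> depth_robust {1..n} E e d"
      using dr M by (meson of_nat_le_iff order_trans)
    then have "chain_robust n E b d"
      using depth_robust_chain_robust[OF _ inc bd(1) \<open>M \<le> n\<close>] by blast
    then have "d * (b + 1) \<le> Pi_bw_cc {1..N} F"
      using 3 F by (intro chain_robust_cost[OF _ l]) (auto simp: d_def)
    then have "real (d * (b + 1)) \<le> real (Pi_bw_cc {1..N} F)" by (rule of_nat_mono)
    then show ?thesis using bd(2) by linarith
  qed
qed

lemma locally_expanding_lift_bound: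
  assumes E: "locally_expanding E" and l: "lifts m (E \<inter> {1..m} \<times> {1..m}) {1..N} F blk tip"
    and F: "F \<subseteq> {1..N} \<times> {1..N}" "\<forall>u v. (u, v) \<in> F \<longrightarrow> u < v" and "m \<ge> 132"
  shows "(real m / 132)^2 \<le> real (Pi_bw_cc {1..N} F)"
proof -
  \<comment> \<open>With \<open>b = d\<close> the requirement reads \<open>65 * d < m\<close>, and
    66 makes the inequality strict. For \<open>m\<close> at least twice 66, rounding down costs at
    most a factor 2, whence 132.\<close>
  define d where "d = m div 66"
  have "66 * d \<le> m" by (simp add: d_def)
  have "d \<ge> 1" using \<open>m \<ge> 132\<close> by (simp add: d_def)
  have "32 * (d + d) + d < m" using \<open>66 * d \<le> m\<close> \<open>d \<ge> 1\<close> by simp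
  then have "d * (d + 1) \<le> Pi_bw_cc {1..N} F"
    using F \<open>d \<ge> 1\<close> locally_expanding_chain_robust[OF E] by (intro chain_robust_cost[OF _ l]) auto
  then have "d * d \<le> Pi_bw_cc {1..N} F" by simp
  then have "real (d * d) \<le> real (Pi_bw_cc {1..N} F)" by (rule of_nat_mono)
  moreover have "m < 66 * d + 66" unfolding d_def by linarith
  then have "real m / 132 \<le> real d" using \<open>m \<ge> 132\<close> by linarith
  then have "(real m / 132)^2 \<le> (real d)^2" by (intro power_mono) auto
  ultimately show ?thesis by (simp add: power2_eq_square)
qed

section \<open>The families of logarithmic indegree and of indegree 2\<close>

lemma num_scales_le_ln:
  assumes "n \<ge> 3"
  shows "real (num_scales n) \<le> 3 * ln (real n)"
proof -
  have "exp 1 \<le> real n" using exp_le assms by linarith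
  then have "1 \<le> ln (real n)" using assms by (subst ln_ge_iff) auto
  moreover have "1 \<le> ln ((2::real) ^ 2)" using exp_le by (subst ln_ge_iff) auto
  then have "(1/2::real) \<le> ln 2" by (subst (asm) ln_realpow) auto
  then have "ln (real n) / ln 2 \<le> ln (real n) / (1/2)"
    using \<open>1 \<le> ln (real n)\<close> by (intro divide_left_mono) auto
  ultimately show ?thesis using num_scales_le_log[of n] assms by (simp add: log_def)
qed

lemma num_scales_pos: "n \<ge> 1 \<Longrightarrow> num_scales n \<ge> 1"
  unfolding num_scales_def using card_mono[OF finite_scales, of "{0}" n] by simp

lemma log_indegree_family:
  assumes E: "locally_expanding E" and inc: "\<forall>u v. (u, v) \<in> E \<longrightarrow> u < v"
    and par: "\<forall>v. finite (parents E v) \<and> card (parents E v) \<le> 60 * num_scales v"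
  defines "G \<equiv> \<lambda>n. E \<inter> {1..n} \<times> {1..n}"
  shows "v \<in> {1..n} \<Longrightarrow> card (parents (G n) v) \<le> 60 * num_scales n"
    and "is_dag {1..n} (G n)"
    and "(\<lambda>n. real (max_indeg {1..n} (G n))) \<in> O(\<lambda>n. ln (real n))"
    and "(\<lambda>n. real (Pi_bw_cc {1..n} (G n))) \<in> \<Omega>(\<lambda>n. (real n)^2)"
proof -
  show card_par: "card (parents (G n) v) \<le> 60 * num_scales n" if "v \<in> {1..n}" for n v
  proof -
    have "card (parents (G n) v) \<le> card (parents E v)"
      using par by (intro card_mono) (auto simp: parents_def G_def)
    also have "\<dots> \<le> 60 * num_scales v" using par by blast
    also have "\<dots> \<le> 60 * num_scales n" using num_scales_mono[of v n] that by simp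
    finally show ?thesis .
  qed
  have incG: "\<forall>u v. (u, v) \<in> G n \<longrightarrow> u < v" for n using inc by (auto simp: G_def)
  have GV: "G n \<subseteq> {1..n} \<times> {1..n}" for n by (simp add: G_def)
  show "is_dag {1..n} (G n)"
    unfolding is_dag_def using GV acyclic_increasing[OF incG] by simp
  have "real (max_indeg {1..n} (G n)) \<le> 180 * ln (real n)" if "n \<ge> 3" for n
  proof -
    have "max_indeg {1..n} (G n) \<le> 60 * num_scales n" using card_par by (intro max_indeg_le) auto
    then have "real (max_indeg {1..n} (G n)) \<le> 60 * real (num_scales n)"
      by (metis of_nat_le_iff of_nat_mult of_nat_numeral)
    then show ?thesis using num_scales_le_ln[OF that] by linarith
  qed
  then show "(\<lambda>n. real (max_indeg {1..n} (G n))) \<in> O(\<lambda>n. ln (real n))"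
    by (intro bigoI[of _ 180] eventually_sequentiallyI[of 3]) auto
  have "(real n / 132)^2 \<le> real (Pi_bw_cc {1..n} (G n))" if "n \<ge> 132" for n
    using locally_expanding_lift_bound[OF E _ GV incG that] lifts_id[OF GV] unfolding G_def by blast
  then show "(\<lambda>n. real (Pi_bw_cc {1..n} (G n))) \<in> \<Omega>(\<lambda>n. (real n)^2)"
    by (intro landau_omega.bigI[of "1/132^2"] eventually_sequentiallyI[of 132])
      (auto simp: power_divide)
qed

text \<open>\<open>K n\<close> bounds the indegree on all initial segments up to \<open>n\<close>,
  and \<open>m n\<close> is the number of gadgets of length \<open>2 * K n\<close> that fit into
  \<open>{1..n}\<close>; the rest is padding. As \<open>m n\<close> is at least of order
  \<open>n / ln n\<close>, the quadratic bound in \<open>m n\<close> is the claimed one.\<close>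

lemma two_indegree_family:
  assumes E: "locally_expanding E" and inc: "\<forall>u v. (u, v) \<in> E \<longrightarrow> u < v"
    and par: "\<forall>v. finite (parents E v) \<and> card (parents E v) \<le> 60 * num_scales v"
  defines "K \<equiv> \<lambda>n. 60 * num_scales n"
  defines "m \<equiv> \<lambda>n. n div (2 * K n)"
  defines "H \<equiv> \<lambda>n. ir_edges (m n) (K n) (E \<inter> {1..m n} \<times> {1..m n})"
  shows "is_dag {1..n} (H n)" and "max_indeg {1..n} (H n) \<le> 2"
    and "(\<lambda>n. real (Pi_bw_cc {1..n} (H n))) \<in> \<Omega>(\<lambda>n. (real n)^2 / (ln (real n))^2)"
proof -
  define G where "G n = E \<inter> {1..m n} \<times> {1..m n}" for n
  have H: "H n = ir_edges (m n) (K n) (G n)" for n by (simp add: H_def G_def)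
  have G: "G n \<subseteq> {1..m n} \<times> {1..m n}" "\<forall>u v. (u, v) \<in> G n \<longrightarrow> u < v" for n
    using inc by (auto simp: G_def)
  have "m n \<le> n" for n by (simp add: m_def)
  then have card_par: "\<forall>v\<in>{1..m n}. card (parents (G n) v) \<le> K n" for n
    using log_indegree_family(1)[OF E inc par, of _ "m n"] num_scales_mono[of "m n" n]
    unfolding G_def K_def by (meson mult_le_mono2 order_trans)
  have mK: "2 * m n * K n \<le> n" for n
    using times_div_less_eq_dividend[of "2 * K n" n] by (simp add: m_def mult_ac)
  have HV: "H n \<subseteq> {1..n} \<times> {1..n}" "\<forall>u v. (u, v) \<in> H n \<longrightarrow> u < v" for n
    unfolding H using ir_edges_subset[OF G(1) card_par mK] G(2) by blast+
  show "is_dag {1..n} (H n)"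
    unfolding is_dag_def using HV acyclic_increasing[OF HV(2)] by simp
  show "max_indeg {1..n} (H n) \<le> 2"
    unfolding H using card_parents_ir_edges[OF card_par] by (intro max_indeg_le) auto
  have bound: "(real (m n) / 132)^2 \<le> real (Pi_bw_cc {1..n} (H n))" if "n \<ge> 1" "m n \<ge> 132" for n
  proof -
    have "1 \<le> K n" using num_scales_pos[OF that(1)] by (simp add: K_def)
    then have "lifts (m n) (E \<inter> {1..m n} \<times> {1..m n}) {1..n} (H n)
        (\<lambda>x. (x - 1) div (2 * K n) + 1) (\<lambda>v. 2 * v * K n)"
      using lifts_ir_edges[OF G(1) card_par mK] unfolding H G_def by blast
    then show ?thesis using locally_expanding_lift_bound[OF E _ HV] that by blast
  qed
  have "eventually (\<lambda>n. real n / (720 * ln (real n)) \<ge> 132) at_top" by real_asymp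
  then have "eventually (\<lambda>n. real (Pi_bw_cc {1..n} (H n)) \<ge> ((real n / (720 * ln (real n))) / 132)^2) at_top"
    using eventually_ge_at_top[of 3]
  proof eventually_elim
    case (elim n)
    \<comment> \<open>\<open>2 * K n\<close> is at most \<open>360 * ln n\<close>, so
      \<open>m n\<close> is at least \<open>2 * x - 1\<close>; the factor 2 absorbs the rounding, as
      \<open>x \<ge> 132\<close>.\<close>
    define x where "x = real n / (720 * ln (real n))"
    have "ln (real n) > 0" using elim by simp
    have "K n \<ge> 1" using num_scales_pos[of n] elim by (simp add: K_def)
    have "real (K n) \<le> 180 * ln (real n)" using num_scales_le_ln[of n] elim by (simp add: K_def)
    then have "real n / (360 * ln (real n)) \<le> real n / (2 * real (K n))"
      using \<open>K n \<ge> 1\<close> by (intro divide_left_mono) auto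
    then have x2: "2 * x \<le> real n / (2 * real (K n))" by (simp add: x_def)
    have "real n / real (2 * K n) - 1 \<le> real (m n)"
    proof -
      have "n < 2 * K n * (m n + 1)"
        using dividend_less_times_div[of "2 * K n" n] \<open>K n \<ge> 1\<close> by (simp add: m_def)
      then have "real n < real (2 * K n) * (real (m n) + 1)"
        by (metis of_nat_1 of_nat_add of_nat_less_iff of_nat_mult)
      then have "real n / real (2 * K n) < real (m n) + 1"
        using \<open>K n \<ge> 1\<close> by (subst pos_divide_less_eq) (auto simp: mult.commute)
      then show ?thesis by linarith
    qed
    then have "x \<le> real (m n)" using x2 elim(1) by (simp add: x_def)
    moreover have "m n \<ge> 132" using calculation elim(1) by (simp add: x_def)
    moreover have "(x / 132)^2 \<le> (real (m n) / 132)^2"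
      using calculation elim(1) by (intro power_mono divide_right_mono) (auto simp: x_def)
    ultimately have "(x / 132)^2 \<le> real (Pi_bw_cc {1..n} (H n))"
      using order_trans[OF _ bound[of n]] elim(2) by auto
    then show ?case unfolding x_def .
  qed
  then show "(\<lambda>n. real (Pi_bw_cc {1..n} (H n))) \<in> \<Omega>(\<lambda>n. (real n)^2 / (ln (real n))^2)"
    by (intro landau_omega.bigI[of "1/(720 * 132)^2"])
      (auto simp: power_divide power_mult_distrib elim!: eventually_mono)
qed

theorem mainTheorem15:
  fixes \<epsilon> :: real
  shows "(\<forall>(n::nat) (E::(nat \<times> nat) set) (\<Delta>::nat).
      0 < \<epsilon> \<and> \<epsilon> < 1 \<and>
      E \<subseteq> {1..n} \<times> {1..n} \<and>
      (\<forall>i. 1 \<le> i \<and> i < n \<longrightarrow> (i, i + 1) \<in> E) \<and>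
      (\<forall>u v. (u, v) \<in> E \<longrightarrow> u < v) \<and>
      \<Delta> = max_indeg {1..n} E \<and> 1 \<le> \<Delta> \<and>
      (\<forall>e d::nat. real (e + d) \<le> (1 - \<epsilon>) * real n \<longrightarrow> depth_robust {1..n} E e d)
      \<longrightarrow>
      real (Pi_bw_cc {1..n} E) \<ge> (1/16 - \<epsilon>/2) * (real n)^2 \<and>
      real (Pi_bw_cc {1..2*n*\<Delta>} (ir_edges n \<Delta> E)) \<ge> (1/16 - \<epsilon>/2) * (real n)^2)
    \<and>
    (\<exists>G :: nat \<Rightarrow> (nat \<times> nat) set.
      (\<forall>n. is_dag {1..n} (G n)) \<and>
      (\<lambda>n. real (max_indeg {1..n} (G n))) \<in> O(\<lambda>n. ln (real n)) \<and>
      (\<lambda>n. real (Pi_bw_cc {1..n} (G n))) \<in> \<Omega>(\<lambda>n. (real n)^2))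
    \<and>
    (\<exists>H :: nat \<Rightarrow> (nat \<times> nat) set.
      (\<forall>n. is_dag {1..n} (H n) \<and> max_indeg {1..n} (H n) \<le> 2) \<and>
      (\<lambda>n. real (Pi_bw_cc {1..n} (H n))) \<in> \<Omega>(\<lambda>n. (real n)^2 / (ln (real n))^2))"
proof (intro conjI allI impI)
  fix n E \<Delta>
  assume A: "0 < \<epsilon> \<and> \<epsilon> < 1 \<and>
      E \<subseteq> {1..n} \<times> {1..n} \<and>
      (\<forall>i. 1 \<le> i \<and> i < n \<longrightarrow> (i, i + 1) \<in> E) \<and>
      (\<forall>u v. (u, v) \<in> E \<longrightarrow> u < v) \<and>
      \<Delta> = max_indeg {1..n} E \<and> 1 \<le> \<Delta> \<and>
      (\<forall>e d::nat. real (e + d) \<le> (1 - \<epsilon>) * real n \<longrightarrow> depth_robust {1..n} E e d)"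
  then have E: "E \<subseteq> {1..n} \<times> {1..n}" and inc: "\<forall>u v. (u, v) \<in> E \<longrightarrow> u < v" and "1 \<le> \<Delta>" by blast+
  have dr: "\<forall>e d::nat. real (e + d) \<le> (1 - \<epsilon>) * real n \<longrightarrow> depth_robust {1..n} E e d"
    using A by blast
  have par: "\<forall>v\<in>{1..n}. card (parents E v) \<le> \<Delta>"
    using A card_parents_le_max_indeg[of "{1..n}"] by blast
  show "(1/16 - \<epsilon>/2) * (real n)^2 \<le> real (Pi_bw_cc {1..n} E)"
    using A E inc by (intro extreme_depth_robust_lift_bound[OF _ _ inc dr lifts_id[OF E]]) auto
  have "n * 1 \<le> n * (2 * \<Delta>)" using \<open>1 \<le> \<Delta>\<close> by (intro mult_le_mono2) simp
  then have "n \<le> 2 * n * \<Delta>" by simp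
  then show "(1/16 - \<epsilon>/2) * (real n)^2 \<le> real (Pi_bw_cc {1..2*n*\<Delta>} (ir_edges n \<Delta> E))"
    using A lifts_ir_edges[OF E par order_refl \<open>1 \<le> \<Delta>\<close>]
      ir_edges_subset[OF E par order_refl] inc
    by (intro extreme_depth_robust_lift_bound[OF _ _ inc dr]) auto
next
  obtain E where E: "locally_expanding E" "\<forall>u v. (u, v) \<in> E \<longrightarrow> u < v"
    "\<forall>v. finite (parents E v) \<and> card (parents E v) \<le> 60 * num_scales v"
    using locally_expanding_exists by blast
  show "\<exists>G :: nat \<Rightarrow> (nat \<times> nat) set.
      (\<forall>n. is_dag {1..n} (G n)) \<and>
      (\<lambda>n. real (max_indeg {1..n} (G n))) \<in> O(\<lambda>n. ln (real n)) \<and>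
      (\<lambda>n. real (Pi_bw_cc {1..n} (G n))) \<in> \<Omega>(\<lambda>n. (real n)^2)"
    by (rule exI[of _ "\<lambda>n. E \<inter> {1..n} \<times> {1..n}"]) (use log_indegree_family(2-4)[OF E] in blast)
  define H where "H n = (let K = 60 * num_scales n; m = n div (2 * K) in
      ir_edges m K (E \<inter> {1..m} \<times> {1..m}))" for n
  show "\<exists>H :: nat \<Rightarrow> (nat \<times> nat) set.
      (\<forall>n. is_dag {1..n} (H n) \<and> max_indeg {1..n} (H n) \<le> 2) \<and>
      (\<lambda>n. real (Pi_bw_cc {1..n} (H n))) \<in> \<Omega>(\<lambda>n. (real n)^2 / (ln (real n))^2)"
    by (rule exI[of _ H]) (use two_indegree_family[OF E] in \<open>simp add: H_def Let_def\<close>)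
qed

end
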